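(* Let $X$ be a compact metric space and $T: X \to X$ a continuous map which is not uniquely ergodic and whose set of periodic measures is dense in the set $\mathcal{M}_T$ of $T$-invariant Borel probability measures. Let $d \geq 1$. Then the map $$R: (C(X, \mathbb{R}^{d}), \|\cdot\|_{\infty}) \to (\mathit{CB}(\mathbb{R}^{d}), d_{H})$$ that associates to each continuous potential $F: X \to \mathbb{R}^d$ its rotation set $R(F)$ is continuous, open, and surjective.
   Context: $\mathcal{M}_T$ denotes the set of $T$-invariant Borel probability measures on $X$, with the weak-$\star$ topology; $T$ is uniquely ergodic if $\mathcal{M}_T$ has exactly one element. For a periodic point $x$ of $T$, $\mu_{\mathcal{O}(x)}$ is the unique $T$-invariant probability measure supported on the (finite) orbit $\mathcal{O}(x)=\{T^j(x): j\ge 0\}$; such measures are called periodic measures, and their density in $\mathcal{M}_T$ is with respect to the weak-$\star$ topology. For $F \in C(X,\mathbb{R}^d)$ (continuous functions $X\to\mathbb{R}^d$), the rotation set is $R(F) = \left\{ \int F \, d\mu : \mu \in \mathcal{M}_T \right\}\subset \mathbb{R}^d$, which is non-empty, compact and convex. $\|\cdot\|$ is the Euclidean norm on $\mathbb{R}^d$ and $\|F\|_\infty = \sup_{x\in X}\|F(x)\|$. $\mathit{CB}(\mathbb{R}^{d})$ is the set of convex bodies of $\mathbb{R}^d$, i.e. non-empty compact convex subsets of $\mathbb{R}^d$ (possibly with empty interior), with the Hausdorff distance $d_{H}(K,L)=\max \{ \sup_{x \in K} \inf_{y \in L} \|x-y\|, \ \sup_{y \in L} \inf_{x \in K} \|x-y\|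 \}$. A map is open if it sends open sets to open sets. *)

theory Defs
  imports "HOL-Probability.Probability"
begin

definition invariant_measures :: "('a::topological_space \<Rightarrow> 'a) \<Rightarrow> 'a measure set" where
  "invariant_measures T =
     {\<mu>. sets \<mu> = sets borel \<and> prob_space \<mu> \<and> distr \<mu> borel T = \<mu>}"

definition uniquely_ergodic :: "('a::topological_space \<Rightarrow> 'a) \<Rightarrow> bool" where
  "uniquely_ergodic T \<longleftrightarrow> (\<exists>!\<mu>. \<mu> \<in> invariant_measures T)"

(* The initial topology for the maps sending mu to the integral of f, where f ranges over
   the (bounded) continuous real functions. *)
definition weak_star_topology :: "('a::topological_space \<Rightarrow> 'a) \<Rightarrow> 'a measure topology" where
  "weak_star_topology T =
     pullback_topology (invariant_measures T)
       (\<lambda>\<mu> (f :: 'a \<Rightarrow>\<^sub>C real). \<integral>x. f x \<partial>\<mu>) (powertop_real UNIV)"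

definition forward_orbit :: "('a \<Rightarrow> 'a) \<Rightarrow> 'a \<Rightarrow> 'a set" where
  "forward_orbit T x = {(T ^^ j) x | j. 0 \<le> j}"

definition periodic_point :: "('a \<Rightarrow> 'a) \<Rightarrow> 'a \<Rightarrow> bool" where
  "periodic_point T x \<longleftrightarrow> (\<exists>n>0. (T ^^ n) x = x)"

(* The orbit of a periodic point is finite, hence closed in a metric space, so being supported
   on the orbit is the same as giving it full measure. *)
definition periodic_measures :: "('a::topological_space \<Rightarrow> 'a) \<Rightarrow> 'a measure set" where
  "periodic_measures T =
     {\<mu> \<in> invariant_measures T. \<exists>x. periodic_point T x \<and> measure \<mu> (forward_orbit T x) = 1}"

definition rotation_set ::
    "('a::topological_space \<Rightarrow> 'a) \<Rightarrow> ('a \<Rightarrow>\<^sub>C 'b::euclidean_space) \<Rightarrow> 'b set" where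
  "rotation_set T F = {\<integral>x. F x \<partial>\<mu> | \<mu>. \<mu> \<in> invariant_measures T}"

definition convex_bodies :: "'b::euclidean_space set set" where
  "convex_bodies = {K. K \<noteq> {} \<and> compact K \<and> convex K}"

(* Set to 0 away from convex bodies, because the locale Metric_space asks for nonnegativity
   on the whole type, while Sup and Inf of unbounded or empty sets of reals are unspecified. *)
definition hausdorff_distance :: "'b::euclidean_space set \<Rightarrow> 'b set \<Rightarrow> real" where
  "hausdorff_distance K L =
     (if K \<in> convex_bodies \<and> L \<in> convex_bodies
      then max (SUP x\<in>K. INF y\<in>L. norm (x - y)) (SUP y\<in>L. INF x\<in>K. norm (x - y))
      else 0)"

lemma hausdorff_distance_infdist:
  assumes "K \<in> convex_bodies" "L \<in> convex_bodies"
  shows "hausdorff_distance K L = max (SUP x\<in>K. infdist x L) (SUP y\<in>L. infdist y K)"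
  using assms
  by (simp add: hausdorff_distance_def convex_bodies_def infdist_notempty dist_norm norm_minus_commute)

lemma bdd_above_infdist:
  assumes "K \<in> convex_bodies"
  shows "bdd_above ((\<lambda>x. infdist x L) ` K)"
proof -
  have "compact ((\<lambda>x. infdist x L) ` K)"
    using assms by (intro compact_continuous_image continuous_intros) (auto simp: convex_bodies_def)
  then show ?thesis
    by (simp add: bounded_imp_bdd_above compact_imp_bounded)
qed

lemma infdist_le_hausdorff_distance:
  assumes "K \<in> convex_bodies" "L \<in> convex_bodies" "x \<in> K"
  shows "infdist x L \<le> hausdorff_distance K L"
  using cSUP_upper[OF assms(3) bdd_above_infdist[OF assms(1)], of L]
  by (simp add: hausdorff_distance_infdist[OF assms(1,2)])

lemma hausdorff_distance_commute: "hausdorff_distance K L = hausdorff_distance L K"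
  by (simp add: hausdorff_distance_def norm_minus_commute max.commute)

lemma hausdorff_distance_leI:
  assumes "K \<in> convex_bodies" "L \<in> convex_bodies"
    and "\<And>x. x \<in> K \<Longrightarrow> infdist x L \<le> e" "\<And>y. y \<in> L \<Longrightarrow> infdist y K \<le> e"
  shows "hausdorff_distance K L \<le> e"
  using assms
  by (auto simp: hausdorff_distance_infdist convex_bodies_def intro!: cSUP_least)

lemma hausdorff_distance_nonneg: "0 \<le> hausdorff_distance K L"
proof (cases "K \<in> convex_bodies \<and> L \<in> convex_bodies")
  case True
  then obtain x where "x \<in> K" by (auto simp: convex_bodies_def)
  with True show ?thesis
    using infdist_le_hausdorff_distance[of K L x] infdist_nonneg[of x L] by linarith
qed (auto simp: hausdorff_distance_def)

lemma infdist_triangle_hausdorff: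
  assumes "K \<in> convex_bodies" "L \<in> convex_bodies" "M \<in> convex_bodies" "x \<in> K"
  shows "infdist x M \<le> hausdorff_distance K L + hausdorff_distance L M"
proof -
  obtain y where y: "y \<in> L" "infdist x L = dist x y"
    using infdist_attains_inf[of L x] assms(2)
    by (auto simp: convex_bodies_def compact_imp_closed)
  have "infdist x M \<le> infdist y M + dist x y"
    by (rule infdist_triangle)
  with y show ?thesis
    using infdist_le_hausdorff_distance[OF assms(1,2,4)]
      infdist_le_hausdorff_distance[OF assms(2,3) y(1)] by linarith
qed

lemma Metric_space_convex_bodies: "Metric_space convex_bodies hausdorff_distance"
proof
  fix K L M :: "'b::euclidean_space set"
  show "0 \<le> hausdorff_distance K L" by (rule hausdorff_distance_nonneg)
  show "hausdorff_distance K L = hausdorff_distance L K" by (rule hausdorff_distance_commute)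
  assume K: "K \<in> convex_bodies" and L: "L \<in> convex_bodies"
  have sub: "A \<subseteq> B" if A: "A \<in> convex_bodies" and B: "B \<in> convex_bodies"
      and 0: "hausdorff_distance A B = 0" for A B :: "'b set"
  proof
    fix x assume "x \<in> A"
    then have "infdist x B = 0"
      using infdist_le_hausdorff_distance[OF A B, of x] 0 infdist_nonneg[of x B] by simp
    then show "x \<in> B"
      using B in_closed_iff_infdist_zero[of B x] by (auto simp: convex_bodies_def compact_imp_closed)
  qed
  show "hausdorff_distance K L = 0 \<longleftrightarrow> K = L"
  proof
    assume "hausdorff_distance K L = 0"
    then show "K = L"
      using sub[OF K L] sub[OF L K] by (auto simp: hausdorff_distance_commute)
  next
    assume "K = L"
    then have "hausdorff_distance K L \<le> 0"
      using K L by (intro hausdorff_distance_leI) auto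
    then show "hausdorff_distance K L = 0"
      using hausdorff_distance_nonneg[of K L] by simp
  qed
  assume M: "M \<in> convex_bodies"
  show "hausdorff_distance K M \<le> hausdorff_distance K L + hausdorff_distance L M"
  proof (rule hausdorff_distance_leI[OF K M])
    show "infdist x M \<le> hausdorff_distance K L + hausdorff_distance L M" if "x \<in> K" for x
      using infdist_triangle_hausdorff[OF K L M that] .
    show "infdist y K \<le> hausdorff_distance K L + hausdorff_distance L M" if "y \<in> M" for y
      using infdist_triangle_hausdorff[OF M L K that]
      by (simp add: hausdorff_distance_commute[of M L] hausdorff_distance_commute[of L K] add.commute)
  qed
qed

abbreviation hausdorff_topology :: "'b::euclidean_space set topology" where
  "hausdorff_topology \<equiv> Metric_space.mtopology convex_bodies hausdorff_distance"

end

theory Submission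
  imports Defs
begin

text \<open>
  Continuity of the rotation set map holds because it is 1-Lipschitz. For the rest, let \<open>R F\<close> have
  Hausdorff distance less than \<open>d\<close> to \<open>K\<close>. Rotation sets are unchanged when \<open>F\<close> is
  perturbed by functions with vanishing integrals, so \<open>F\<close> may be replaced by a long Birkhoff average,
  whose values lie near \<open>R F\<close>, hence within \<open>d\<close> of \<open>K\<close>; projecting onto \<open>K\<close> gives \<open>P\<close>.
  For each point \<open>k\<close> of a finite net of \<open>K\<close> there is a periodic measure whose \<open>P\<close>-integral is within
  \<open>2 d\<close> of \<open>k\<close>, with distinct (hence disjoint) orbits for distinct points: here density and the
  failure of unique ergodicity enter. Averaging \<open>P\<close> over a common multiple of the periods makes it
  constant on each orbit, and correcting it there to the value \<open>k\<close>, followed by another projection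
  onto \<open>K\<close>, yields \<open>G\<close> within \<open>3 d\<close> of \<open>F\<close> with \<open>R G\<close> contained in \<open>K\<close> and containing the
  net. Iterating with \<open>d / 2 ^ n\<close> gives in the limit \<open>R G = K\<close> with \<open>G\<close> within \<open>6 d\<close> of \<open>F\<close>,
  so the map is open, and starting from \<open>F = 0\<close> also surjective. Compactness of the set of invariant
  measures comes from the Tychonoff theorem and the Riesz representation theorem.
\<close>

section \<open>Riesz representation on a compact metric space\<close>

text \<open>A positive normalised linear functional, taken on plain functions under continuity
  assumptions so that pointwise arithmetic needs no wrapping. Its values at discontinuous functions
  are unconstrained.\<close>

locale mean_functional =
  fixes l :: "('a::metric_space \<Rightarrow> real) \<Rightarrow> real"
  assumes compact_space: "compact (UNIV :: 'a set)"
    and add: "continuous_on UNIV f \<Longrightarrow> continuous_on UNIV g \<Longrightarrow> l (\<lambda>x. f x + g x) = l f + l g"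
    and scale: "continuous_on UNIV f \<Longrightarrow> l (\<lambda>x. c * f x) = c * l f"
    and nonneg: "continuous_on UNIV f \<Longrightarrow> (\<And>x. 0 \<le> f x) \<Longrightarrow> 0 \<le> l f"
    and one: "l (\<lambda>_. 1) = 1"
begin

lemma const: "l (\<lambda>_. c) = c"
  using scale[of "\<lambda>_. 1" c] one by simp

lemma diff:
  assumes "continuous_on UNIV f" "continuous_on UNIV g"
  shows "l (\<lambda>x. f x - g x) = l f - l g"
  using add[of "\<lambda>x. f x - g x" g] assms by (simp add: continuous_intros)

lemma mono:
  assumes "continuous_on UNIV f" "continuous_on UNIV g" "\<And>x. f x \<le> g x"
  shows "l f \<le> l g"
  using nonneg[of "\<lambda>x. g x - f x"] assms diff[of g f] by (simp add: continuous_intros)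

lemma sum:
  assumes "finite I" "\<And>i. i \<in> I \<Longrightarrow> continuous_on UNIV (f i)"
  shows "l (\<lambda>x. \<Sum>i\<in>I. f i x) = (\<Sum>i\<in>I. l (f i))"
  using assms by (induction I rule: finite_induct) (auto simp: const add continuous_intros)

section \<open>The outer measure of a positive functional\<close>

definition covers :: "'a set \<Rightarrow> (nat \<Rightarrow> 'a \<Rightarrow> real) set" where
  "covers A = {f. (\<forall>n. continuous_on UNIV (f n)) \<and> (\<forall>n x. 0 \<le> f n x) \<and>
     (\<forall>x\<in>A. 1 \<le> (\<Sum>n. ennreal (f n x)))}"

text \<open>
  The Daniell upper integral of an indicator. Unlike the usual construction from open sets, it is
  countably subadditive for trivial reasons.
\<close>

definition outer :: "'a set \<Rightarrow> ennreal" where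
  "outer A = (INF f\<in>covers A. \<Sum>n. ennreal (l (f n)))"

lemma outer_le: "f \<in> covers A \<Longrightarrow> outer A \<le> (\<Sum>n. ennreal (l (f n)))"
  unfolding outer_def by (rule INF_lower)

text \<open>Flattening by \<open>prod_decode\<close> turns a double family into one cover. Covers
  arise as double families both in countable subadditivity and in the telescoping argument for
  closed sets.\<close>

lemma outer_le_double:
  assumes "\<And>m n. continuous_on UNIV (g m n)" "\<And>m n x. 0 \<le> g m n x"
    and "\<And>x. x \<in> A \<Longrightarrow> 1 \<le> (\<Sum>m. \<Sum>n. ennreal (g m n x))"
  shows "outer A \<le> (\<Sum>m. \<Sum>n. ennreal (l (g m n)))"
proof -
  let ?f = "\<lambda>i. case_prod g (prod_decode i)"
  have "?f \<in> covers A"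
    unfolding covers_def
  proof (intro CollectI conjI allI ballI)
    fix x assume "x \<in> A"
    have "(\<Sum>i. ennreal (?f i x)) = (\<Sum>m. \<Sum>n. ennreal (g m n x))"
      by (subst suminf_ennreal_2dimen[where f="\<lambda>(m, n). ennreal (g m n x)", symmetric])
        (auto simp: case_prod_beta)
    with assms(3)[OF \<open>x \<in> A\<close>] show "1 \<le> (\<Sum>i. ennreal (?f i x))" by simp
  qed (auto simp: assms(1,2) case_prod_beta)
  then have "outer A \<le> (\<Sum>i. ennreal (l (?f i)))" by (rule outer_le)
  also have "\<dots> = (\<Sum>m. \<Sum>n. ennreal (l (g m n)))"
    by (subst suminf_ennreal_2dimen[where f="\<lambda>(m, n). ennreal (l (g m n))", symmetric])
      (auto simp: case_prod_beta)
  finally show ?thesis .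
qed

text \<open>Zero functions pad \<open>f\<close> to a sequence.\<close>

lemma outer_le_single:
  assumes "continuous_on UNIV f" "\<And>x. 0 \<le> f x" "\<And>x. x \<in> A \<Longrightarrow> 1 \<le> f x"
  shows "outer A \<le> ennreal (l f)"
proof -
  let ?f = "\<lambda>n::nat. if n = 0 then f else (\<lambda>_. 0)"
  have single: "(\<Sum>n. ennreal (?f n x)) = ennreal (f x)" for x
    using suminf_finite[of "{0}" "\<lambda>n. ennreal (?f n x)"] by auto
  have single': "(\<Sum>n. ennreal (l (?f n))) = ennreal (l f)"
    using suminf_finite[of "{0}" "\<lambda>n. ennreal (l (?f n))"] by (auto simp: const)
  have "?f \<in> covers A"
    unfolding covers_def
  proof (intro CollectI conjI allI ballI)
    fix x assume "x \<in> A"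
    show "1 \<le> (\<Sum>n. ennreal (?f n x))"
      unfolding single using assms(3)[OF \<open>x \<in> A\<close>] by simp
  qed (auto simp: assms)
  from outer_le[OF this] show ?thesis unfolding single' .
qed

lemma outer_measure_space_outer: "outer_measure_space (Pow UNIV) outer"
  unfolding outer_measure_space_def positive_def increasing_def countably_subadditive_def
proof (intro conjI ballI allI impI)
  show "outer {} = 0"
    using outer_le_single[of "\<lambda>_. 0" "{}"] by (simp add: const)
next
  fix A B :: "'a set" assume "A \<subseteq> B"
  then have "covers B \<subseteq> covers A" by (auto simp: covers_def)
  then show "outer A \<le> outer B" unfolding outer_def by (rule INF_superset_mono) auto
next
  fix A :: "nat \<Rightarrow> 'a set"
  show "outer (\<Union>i. A i) \<le> (\<Sum>i. outer (A i))"
  proof (rule ennreal_le_epsilon)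
    fix e :: real assume "0 < e" and fin: "(\<Sum>i. outer (A i)) < top"
    have "\<exists>f\<in>covers (A i). (\<Sum>n. ennreal (l (f n))) \<le> outer (A i) + ennreal (e * (1/2) ^ Suc i)" for i
    proof -
      \<comment> \<open>Adding a positive error gives a strict inequality only at a finite value;
        the constant cover 1 provides finiteness.\<close>
      have "outer (A i) < top"
      proof -
        have "outer (A i) \<le> ennreal (l (\<lambda>_. 1))" by (rule outer_le_single) auto
        then show ?thesis using ennreal_less_top order_le_less_trans by blast
      qed
      then have "outer (A i) < outer (A i) + ennreal (e * (1/2) ^ Suc i)"
        using \<open>0 < e\<close> by (simp add: ennreal_zero_less_mult_iff ennreal_add_left_cancel_less)
      then show ?thesis unfolding outer_def INF_less_iff by (meson less_imp_le)
    qed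
    then obtain g where g: "\<And>i. g i \<in> covers (A i)"
      and le: "\<And>i. (\<Sum>n. ennreal (l (g i n))) \<le> outer (A i) + ennreal (e * (1/2) ^ Suc i)"
      by metis
    have "outer (\<Union>i. A i) \<le> (\<Sum>m. \<Sum>n. ennreal (l (g m n)))"
    proof (rule outer_le_double)
      fix x assume "x \<in> (\<Union>i. A i)"
      then obtain i where "x \<in> A i" by auto
      then have "1 \<le> (\<Sum>n. ennreal (g i n x))" using g[of i] by (auto simp: covers_def)
      also have "\<dots> \<le> (\<Sum>m. \<Sum>n. ennreal (g m n x))"
        using sum_le_suminf[of "\<lambda>m. \<Sum>n. ennreal (g m n x)" "{i}"] by simp
      finally show "1 \<le> (\<Sum>m. \<Sum>n. ennreal (g m n x))" .
    qed (use g in \<open>auto simp: covers_def\<close>)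
    also have "\<dots> \<le> (\<Sum>i. outer (A i) + ennreal (e * (1/2) ^ Suc i))"
      by (intro suminf_le le) auto
    also have "\<dots> = (\<Sum>i. outer (A i)) + (\<Sum>i. ennreal (e * (1/2) ^ Suc i))"
      by (rule suminf_add[symmetric]) auto
    also have "(\<Sum>i. ennreal (e * (1/2) ^ Suc i)) = ennreal e"
    proof -
      have "(\<lambda>i. e * (1/2) ^ Suc i) sums (e * 1)" by (intro sums_mult power_half_series)
      then show ?thesis using \<open>0 < e\<close> by (intro suminf_ennreal_eq) auto
    qed
    finally show "outer (\<Union>i. A i) \<le> (\<Sum>i. outer (A i)) + ennreal e" .
  qed
qed

text \<open>
  A cover \<open>f\<close> of \<open>E\<close> splits into the cover \<open>f n * (1 - p k)\<close> of \<open>C \<inter> E\<close> and the cover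
  \<open>f n * (p (Suc k) - p k)\<close> of \<open>E - C\<close>, where \<open>p k\<close> increases to the indicator of the complement
  of \<open>C\<close>; the second one has the right total because it telescopes.
\<close>

lemma closed_in_lambda_system:
  assumes "closed C"
  shows "C \<in> lambda_system UNIV (Pow UNIV) outer"
\<comment> \<open>\<open>infdist x {}\<close> is 0 by convention, so for empty \<open>C\<close> the
  functions \<open>p\<close> below would not tend to 1.\<close>
proof (cases "C = {}")
  case True
  then show ?thesis
    using outer_measure_space_outer
    by (auto simp: lambda_system_def outer_measure_space_def positive_def)
next
  case False
  define p where "p n x = min 1 (real n * infdist x C)" for n and x :: 'a
  have p_cont: "continuous_on UNIV (p n)" for n
    unfolding p_def by (intro continuous_intros)
  have p_range: "0 \<le> p n x" "p n x \<le> 1" for n x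
    by (auto simp: p_def infdist_nonneg)
  have p_mono: "p n x \<le> p (Suc n) x" for n x
    unfolding p_def by (intro min.mono mult_right_mono) (auto simp: infdist_nonneg)
  have p_0: "p 0 x = 0" for x by (simp add: p_def)
  have p_C: "p n x = 0" if "x \<in> C" for n x
    using that by (simp add: p_def)
  have p_lim: "(\<lambda>n. p n x) \<longlonglongrightarrow> 1" if "x \<notin> C" for x
  proof -
    have "0 < infdist x C"
      using that assms False infdist_nonneg[of x C] in_closed_iff_infdist_zero[of C x] by fastforce
    then obtain n where n: "1 \<le> real n * infdist x C"
      using reals_Archimedean3[of "infdist x C"] by (meson less_imp_le)
    have "p k x = 1" if "k \<ge> n" for k
    proof -
      have "real n * infdist x C \<le> real k * infdist x C"
        using that by (intro mult_right_mono) (auto simp: infdist_nonneg)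
      with n show ?thesis by (simp add: p_def)
    qed
    then show ?thesis by (intro tendsto_eventually) (auto simp: eventually_sequentially)
  qed
  have "outer (C \<inter> E) + outer ((UNIV - C) \<inter> E) \<le> (\<Sum>n. ennreal (l (f n)))" if f: "f \<in> covers E" for E f
  proof -
    have f_cont: "continuous_on UNIV (f n)" and f_nn: "0 \<le> f n x" for n x
      using f by (auto simp: covers_def)
    have f_cov: "1 \<le> (\<Sum>n. ennreal (f n x))" if "x \<in> E" for x
      using f that by (auto simp: covers_def)
    have fp_nn: "0 \<le> l (\<lambda>x. f n x * p k x)" for n k
      using f_cont f_nn p_cont p_range by (intro nonneg continuous_intros) auto
    \<comment> \<open>For fixed \<open>k\<close> the part \<open>f n * p k\<close> is kept as it
      stands; its supremum over \<open>k\<close> is what bounds the outer measure of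
      \<open>E - C\<close> below.\<close>
    have split: "outer (C \<inter> E) + (\<Sum>n. ennreal (l (\<lambda>x. f n x * p k x))) \<le> (\<Sum>n. ennreal (l (f n)))" for k
    proof -
      have "(\<lambda>n x. f n x * (1 - p k x)) \<in> covers (C \<inter> E)"
        using f_cont p_cont f_nn p_range f_cov
        by (auto simp: covers_def p_C intro!: continuous_intros)
      from outer_le[OF this]
      have "outer (C \<inter> E) + (\<Sum>n. ennreal (l (\<lambda>x. f n x * p k x)))
        \<le> (\<Sum>n. ennreal (l (\<lambda>x. f n x * (1 - p k x)))) + (\<Sum>n. ennreal (l (\<lambda>x. f n x * p k x)))"
        by (intro add_right_mono)
      also have "\<dots> = (\<Sum>n. ennreal (l (\<lambda>x. f n x * (1 - p k x))) + ennreal (l (\<lambda>x. f n x * p k x)))"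
        by (rule suminf_add) auto
      also have "\<dots> = (\<Sum>n. ennreal (l (f n)))"
      proof (intro arg_cong[where f=suminf] ext)
        fix n
        have "0 \<le> l (\<lambda>x. f n x * (1 - p k x))"
          using f_cont f_nn p_cont p_range by (intro nonneg continuous_intros) auto
        moreover have "l (\<lambda>x. f n x * (1 - p k x) + f n x * p k x)
            = l (\<lambda>x. f n x * (1 - p k x)) + l (\<lambda>x. f n x * p k x)"
          using f_cont p_cont by (intro add continuous_intros)
        ultimately show "ennreal (l (\<lambda>x. f n x * (1 - p k x))) + ennreal (l (\<lambda>x. f n x * p k x)) = ennreal (l (f n))"
          using fp_nn[of n k] by (simp add: ennreal_plus[symmetric] algebra_simps del: ennreal_plus)
      qed
      finally show ?thesis .
    qed
    have "outer ((UNIV - C) \<inter> E) \<le> (\<Sum>n. \<Sum>k. ennreal (l (\<lambda>x. f n x * (p (Suc k) x - p k x))))"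
    proof (rule outer_le_double)
      fix x assume x: "x \<in> (UNIV - C) \<inter> E"
      have "(\<Sum>k. ennreal (f n x * (p (Suc k) x - p k x))) = ennreal (f n x)" for n
      proof (rule suminf_ennreal_eq)
        have "(\<lambda>k. p (Suc k) x - p k x) sums (1 - p 0 x)"
          using x by (intro telescope_sums p_lim) auto
        from sums_mult[OF this, of "f n x"]
        show "(\<lambda>k. f n x * (p (Suc k) x - p k x)) sums f n x" by (simp add: p_0)
      qed (use f_nn p_mono in auto)
      then show "1 \<le> (\<Sum>n. \<Sum>k. ennreal (f n x * (p (Suc k) x - p k x)))"
        using x f_cov by simp
    qed (use f_cont p_cont f_nn p_mono in \<open>auto intro!: continuous_intros\<close>)
    also have "\<dots> = (\<Sum>n. SUP k. ennreal (l (\<lambda>x. f n x * p k x)))"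
    proof (intro arg_cong[where f=suminf] ext)
      fix n
      have nn: "0 \<le> l (\<lambda>x. f n x * (p (Suc k) x - p k x))" for k
        using f_cont p_cont f_nn p_mono by (intro nonneg continuous_intros) auto
      have "(\<Sum>k<m. ennreal (l (\<lambda>x. f n x * (p (Suc k) x - p k x)))) = ennreal (l (\<lambda>x. f n x * p m x))" for m
      proof -
        have "l (\<lambda>x. f n x * (p (Suc k) x - p k x)) = l (\<lambda>x. f n x * p (Suc k) x) - l (\<lambda>x. f n x * p k x)" for k
          using f_cont p_cont by (subst diff[symmetric]) (auto intro!: continuous_intros simp: algebra_simps)
        then have "(\<Sum>k<m. l (\<lambda>x. f n x * (p (Suc k) x - p k x))) = l (\<lambda>x. f n x * p m x)"
          using sum_lessThan_telescope[of "\<lambda>k. l (\<lambda>x. f n x * p k x)" m] by (simp add: p_0 const)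
        with nn show ?thesis by (simp add: sum_ennreal)
      qed
      then show "(\<Sum>k. ennreal (l (\<lambda>x. f n x * (p (Suc k) x - p k x)))) = (SUP k. ennreal (l (\<lambda>x. f n x * p k x)))"
        by (simp add: suminf_eq_SUP)
    qed
    \<comment> \<open>Monotone convergence: each term increases with \<open>k\<close>, so sum and
      supremum may be exchanged.\<close>
    also have "\<dots> = (SUP k. \<Sum>n. ennreal (l (\<lambda>x. f n x * p k x)))"
    proof (rule ennreal_suminf_SUP_eq, rule incseq_SucI)
      show "ennreal (l (\<lambda>x. f n x * p k x)) \<le> ennreal (l (\<lambda>x. f n x * p (Suc k) x))" for n k
        using f_cont p_cont f_nn p_mono
        by (intro ennreal_leI mono continuous_intros mult_left_mono) auto
    qed
    finally have "outer (C \<inter> E) + outer ((UNIV - C) \<inter> E)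
        \<le> outer (C \<inter> E) + (SUP k. \<Sum>n. ennreal (l (\<lambda>x. f n x * p k x)))"
      by (intro add_left_mono)
    also have "\<dots> = (SUP k. outer (C \<inter> E) + (\<Sum>n. ennreal (l (\<lambda>x. f n x * p k x))))"
      by (simp add: ennreal_SUP_add_right)
    also have "\<dots> \<le> (\<Sum>n. ennreal (l (f n)))" by (intro SUP_least split)
    finally show ?thesis .
  qed
  then have le: "outer (C \<inter> E) + outer ((UNIV - C) \<inter> E) \<le> outer E" for E
    unfolding outer_def[of E] by (intro INF_greatest)
  have ge: "outer E \<le> outer (C \<inter> E) + outer ((UNIV - C) \<inter> E)" for E
  proof -
    have "subadditive (Pow UNIV) outer"
      using outer_measure_space_outer unfolding outer_measure_space_def
      by (intro ring_of_sets.countably_subadditive_subadditive[OF ring_of_sets_Pow]) auto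
    from subadditiveD[OF this, of "C \<inter> E" "(UNIV - C) \<inter> E"]
    show ?thesis by (auto simp: Int_Un_distrib2[symmetric])
  qed
  show ?thesis
    unfolding lambda_system_def using le ge by (auto intro!: antisym)
qed

text \<open>Dini's argument: the partial sums of a cover increase, so by compactness a single finite
  one is at least \<open>1 - e\<close> everywhere, and \<open>l\<close> respects finite
  sums.\<close>

lemma one_le_outer_UNIV: "1 \<le> outer UNIV"
  unfolding outer_def
proof (rule INF_greatest)
  fix f assume f: "f \<in> covers UNIV"
  have f_cont: "continuous_on UNIV (f n)" and f_nn: "0 \<le> f n x"
    and f_cov: "1 \<le> (\<Sum>n. ennreal (f n x))" for n x
    using f by (auto simp: covers_def)
  show "1 \<le> (\<Sum>n. ennreal (l (f n)))"
  proof (rule ennreal_le_epsilon)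
    fix e :: real assume "0 < e"
    define U where "U n = {x. 1 - e < (\<Sum>k<n. f k x)}" for n
    have "open (U n)" for n
      unfolding U_def using f_cont
      by (intro open_Collect_less continuous_intros) auto
    moreover have "UNIV \<subseteq> (\<Union>n. U n)"
    proof
      fix x
      have "ennreal (1 - e) < 1" using \<open>0 < e\<close> by (simp add: ennreal_less_one_iff)
      also have "1 \<le> (SUP n. \<Sum>k<n. ennreal (f k x))"
        using f_cov[of x] by (simp add: suminf_eq_SUP)
      finally obtain n where "ennreal (1 - e) < (\<Sum>k<n. ennreal (f k x))"
        by (auto simp: less_SUP_iff)
      then have "1 - e < (\<Sum>k<n. f k x)"
        using f_nn by (simp add: sum_ennreal) (meson ennreal_leI leD le_less_linear)
      then show "x \<in> (\<Union>n. U n)" by (auto simp: U_def)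
    qed
    ultimately obtain I where I: "finite I" "UNIV \<subseteq> (\<Union>n\<in>I. U n)"
      using compactE_image[OF compact_space, of UNIV U] by (metis (no_types, lifting))
    define N where "N = Max I"
    have "1 - e \<le> (\<Sum>k<N. f k x)" for x
    proof -
      obtain n where n: "n \<in> I" "1 - e < (\<Sum>k<n. f k x)"
        using I by (auto simp: U_def)
      have "n \<le> N" unfolding N_def using n I by simp
      then have "(\<Sum>k<n. f k x) \<le> (\<Sum>k<N. f k x)" using f_nn by (intro sum_mono2) auto
      with n show ?thesis by simp
    qed
    then have "l (\<lambda>_. 1 - e) \<le> l (\<lambda>x. \<Sum>k<N. f k x)"
      using f_cont by (intro mono continuous_intros) auto
    then have "1 - e \<le> (\<Sum>k<N. l (f k))"
      unfolding const sum[of "{..<N}" f, OF finite_lessThan f_cont] .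
    then have "ennreal 1 \<le> ennreal ((\<Sum>k<N. l (f k)) + e)" by (intro ennreal_leI) simp
    also have "\<dots> = (\<Sum>k<N. ennreal (l (f k))) + ennreal e"
      using \<open>0 < e\<close> nonneg f_cont f_nn by (simp add: sum_nonneg)
    also have "\<dots> \<le> (\<Sum>k. ennreal (l (f k))) + ennreal e"
      by (intro add_right_mono sum_le_suminf) auto
    finally show "1 \<le> (\<Sum>k. ennreal (l (f k))) + ennreal e" by simp
  qed
qed

text \<open>Caratheodory's construction gives a Borel measure, since the sets measurable for
  \<open>outer\<close> include the closed ones. For the integrals the inequality
  \<open>\<le>\<close> suffices: applied to \<open>- f\<close> it yields the converse.\<close>

theorem riesz_representation:
  "\<exists>\<mu>. sets \<mu> = sets borel \<and> prob_space \<mu> \<and>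
     (\<forall>f. continuous_on UNIV f \<longrightarrow> (\<integral>x. f x \<partial>\<mu>) = l f)"
proof -
  define \<mu> where "\<mu> = measure_of (UNIV :: 'a set) (sets borel) outer"
  have "measure_space UNIV (lambda_system UNIV (Pow UNIV) outer) outer"
    using sigma_algebra.caratheodory_lemma[OF sigma_algebra_Pow outer_measure_space_outer] by simp
  then have ms: "measure_space UNIV (sets (borel :: 'a measure)) outer"
  proof (rule measure_down)
    show "sigma_algebra UNIV (sets (borel :: 'a measure))"
      using sets.sigma_algebra_axioms[of "borel :: 'a measure"] by simp
    have "sets (borel :: 'a measure) = sigma_sets UNIV (Collect closed)"
      by (simp add: borel_eq_closed)
    also have "\<dots> \<subseteq> lambda_system UNIV (Pow UNIV) outer"
      using \<open>measure_space UNIV (lambda_system UNIV (Pow UNIV) outer) outer\<close> closed_in_lambda_system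
      unfolding measure_space_def by (intro sigma_algebra.sigma_sets_subset) auto
    finally show "sets (borel :: 'a measure) \<subseteq> lambda_system UNIV (Pow UNIV) outer" .
  qed
  have sets_\<mu>[measurable_cong]: "sets \<mu> = sets borel"
    unfolding \<mu>_def using sets.sigma_sets_eq[of "borel :: 'a measure"] by (simp add: sets_measure_of_conv)
  have space_\<mu>: "space \<mu> = UNIV"
    by (simp add: \<mu>_def space_measure_of_conv)
  have em: "emeasure \<mu> A = outer A" if "A \<in> sets borel" for A
    unfolding \<mu>_def using that ms sets.sigma_sets_eq[of "borel :: 'a measure"]
    by (intro emeasure_measure_of_sigma) (auto simp: measure_space_def)
  have "outer UNIV = 1"
    using one_le_outer_UNIV outer_le_single[of "\<lambda>_. 1" UNIV] one by (auto intro: antisym)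
  then have prob: "prob_space \<mu>"
    by (intro prob_spaceI) (simp add: em space_\<mu>)
  interpret prob_space \<mu> by (rule prob)
  have prob_UNIV: "measure \<mu> UNIV = 1"
    using prob_space by (simp add: space_\<mu>)
  have cont_meas: "f \<in> borel_measurable \<mu>" if "continuous_on UNIV f" for f :: "'a \<Rightarrow> real"
    using borel_measurable_continuous_onI[OF that] by (simp add: measurable_cong_sets[OF sets_\<mu> refl])
  have bdd: "\<exists>B. \<forall>x. \<bar>f x\<bar> \<le> B" if "continuous_on UNIV f" for f :: "'a \<Rightarrow> real"
    using compact_imp_bounded[OF compact_continuous_image[OF that compact_space]]
    by (auto simp: bounded_iff)
  have int: "integrable \<mu> f" if f: "continuous_on UNIV f" for f :: "'a \<Rightarrow> real"
  proof -
    obtain B where "\<forall>x. \<bar>f x\<bar> \<le> B" using bdd[OF f] by blast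
    then show ?thesis by (intro integrable_const_bound[of _ B] cont_meas f) auto
  qed
  \<comment> \<open>Cut \<open>real N * f\<close> into \<open>N\<close> layers \<open>h k\<close> of
    height at most 1. On \<open>A k\<close> the layer \<open>h k\<close> is full, so
    \<open>A k\<close> has measure at most \<open>l (h k)\<close>, and \<open>real N * f\<close>
    exceeds the number of full layers by at most 1. Dividing by \<open>N\<close> leaves the error
    \<open>1 / N\<close>.\<close>
  have le01: "(\<integral>x. f x \<partial>\<mu>) \<le> l f"
    if f: "continuous_on UNIV f" and f01: "\<And>x. 0 \<le> f x" "\<And>x. f x \<le> 1" for f :: "'a \<Rightarrow> real"
  proof (rule field_le_epsilon)
    fix e :: real assume "0 < e"
    then obtain N where N: "0 < N" "1 / real N < e"
      using reals_Archimedean2[of "1/e"]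
      by (metis nat_approx_posE of_nat_0_less_iff inverse_eq_divide zero_less_Suc ex_inverse_of_nat_less)
    define h where "h k x = max 0 (min 1 (real N * f x - real k))" for k x
    have h_cont: "continuous_on UNIV (h k)" for k
      unfolding h_def using f by (intro continuous_intros)
    define A where "A k = {x. real (Suc k) \<le> real N * f x}" for k
    have A_sets: "A k \<in> sets borel" for k
      unfolding A_def using f by (intro borel_closed closed_Collect_le continuous_intros)
    have outer_A: "measure \<mu> (A k) \<le> l (h k)" for k
    proof -
      have "emeasure \<mu> (A k) \<le> ennreal (l (h k))"
        unfolding em[OF A_sets]
        by (rule outer_le_single[OF h_cont]) (auto simp: h_def A_def)
      moreover have "0 \<le> l (h k)" by (rule nonneg[OF h_cont]) (simp add: h_def)
      ultimately show ?thesis by (simp add: emeasure_eq_measure)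
    qed
    \<comment> \<open>Stated for every \<open>n\<close> to allow induction; at \<open>n = N\<close>
      the minimum disappears because \<open>f \<le> 1\<close>.\<close>
    have tele: "(\<Sum>k<n. h k x) = min (real n) (real N * f x)" for n x
    proof (induction n)
      case (Suc n)
      then show ?case using f01(1)[of x] by (auto simp: h_def min_def max_def)
    qed (use f01 in auto)
    then have sum_h: "(\<Sum>k<N. h k x) = real N * f x" for x
      using f01(2)[of x] mult_left_le[of "f x" "real N"] by simp
    have point: "real N * f x \<le> 1 + (\<Sum>k<N. indicator (A k) x)" for x
    proof -
      have "min (real n) (real N * f x) \<le> 1 + (\<Sum>k<n. indicator (A k) x)" for n
      proof (induction n)
        case (Suc n)
        show ?case
        proof (cases "real (Suc n) \<le> real N * f x")
          case True
          have "real (Suc n) = (\<Sum>k<Suc n. 1)" by simp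
          also have "\<dots> \<le> (\<Sum>k<Suc n. indicator (A k) x)"
            using True by (intro sum_mono) (auto simp: A_def indicator_def)
          finally show ?thesis by simp
        next
          case False
          show ?thesis
          proof (cases "real n \<le> real N * f x")
            case True
            have "real n = (\<Sum>k<n. 1)" by simp
            also have "\<dots> \<le> (\<Sum>k<n. indicator (A k) x)"
              using True by (intro sum_mono) (auto simp: A_def indicator_def)
            finally show ?thesis using False by (simp add: A_def)
          next
            case F2: False
            then show ?thesis using Suc False by (simp add: A_def)
          qed
        qed
      qed simp
      from this[of N] show ?thesis
        using f01(2)[of x] mult_left_le[of "f x" "real N"] by simp
    qed
    have ind_int: "integrable \<mu> (\<lambda>x. indicat_real (A k) x)" for k
      using A_sets by (intro integrable_real_indicator) (auto simp: sets_\<mu> emeasure_eq_measure)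
    have "real N * (\<integral>x. f x \<partial>\<mu>) = (\<integral>x. real N * f x \<partial>\<mu>)" by simp
    also have "\<dots> \<le> (\<integral>x. 1 + (\<Sum>k<N. indicat_real (A k) x) \<partial>\<mu>)"
      using int[OF f] ind_int by (intro integral_mono point) auto
    also have "\<dots> = 1 + (\<Sum>k<N. measure \<mu> (A k))"
      using ind_int A_sets by (simp add: Bochner_Integration.integral_add Bochner_Integration.integral_sum sets_\<mu> space_\<mu> prob_UNIV)
    also have "\<dots> \<le> 1 + (\<Sum>k<N. l (h k))"
      by (intro add_left_mono sum_mono outer_A)
    also have "(\<Sum>k<N. l (h k)) = l (\<lambda>x. \<Sum>k<N. h k x)"
      using h_cont by (simp add: sum)
    also have "\<dots> = real N * l f" by (simp add: sum_h scale f)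
    finally have "(\<integral>x. f x \<partial>\<mu>) \<le> 1 / real N + l f"
      using N by (simp add: field_simps)
    then show "(\<integral>x. f x \<partial>\<mu>) \<le> l f + e" using N by simp
  qed
  have le: "(\<integral>x. f x \<partial>\<mu>) \<le> l f" if f: "continuous_on UNIV f" for f :: "'a \<Rightarrow> real"
  proof -
    obtain B where B: "\<And>x. \<bar>f x\<bar> \<le> B" using bdd[OF f] by blast
    \<comment> \<open>Rescaling to \<open>1/2 + f / (2 * c)\<close> moves the values into the unit
      interval; the added 1 keeps \<open>c\<close> positive when \<open>f\<close> vanishes.\<close>
    define c where "c = B + 1"
    have c: "0 < c"
      using B[of undefined] abs_ge_zero[of "f undefined"] unfolding c_def by linarith
    have f_le_c: "\<bar>f x\<bar> \<le> c" for x
      using B[of x] by (simp add: c_def)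
    have bnd: "0 \<le> 1/2 + (1 / (2*c)) * f x" "1/2 + (1 / (2*c)) * f x \<le> 1" for x
      using c f_le_c[of x] by (auto simp: field_simps abs_le_iff)
    have "(\<integral>x. 1/2 + (1 / (2*c)) * f x \<partial>\<mu>) \<le> l (\<lambda>x. 1/2 + (1 / (2*c)) * f x)"
      using f bnd by (intro le01 continuous_intros)
    also have "l (\<lambda>x. 1/2 + (1 / (2*c)) * f x) = 1/2 + (1 / (2*c)) * l f"
      using f by (subst add) (auto intro!: continuous_intros simp only: const scale)
    finally show ?thesis using c int[OF f] by (simp add: prob_space field_simps)
  qed
  have "(\<integral>x. f x \<partial>\<mu>) = l f" if f: "continuous_on UNIV f" for f :: "'a \<Rightarrow> real"
    using le[OF f] le[of "\<lambda>x. -1 * f x"] scale[OF f, of "-1"] f by (simp add: continuous_intros)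
  with prob sets_\<mu> show ?thesis by blast
qed

end

section \<open>Invariant means and Birkhoff averages\<close>

lemma apply_Bcontfun_compact:
  fixes f :: "'a::topological_space \<Rightarrow> 'b::metric_space"
  assumes "compact (UNIV :: 'a set)" "continuous_on UNIV f"
  shows "apply_bcontfun (Bcontfun f) = f"
  using assms by (intro Bcontfun_inverse) (simp add: bcontfun_def compact_continuous_image compact_imp_bounded)

text \<open>A hyperplane separating the integral from \<open>K\<close> would also separate it from
  all values of \<open>f\<close>, contradicting monotonicity of the integral.\<close>

lemma integral_mem_closed_convex:
  fixes f :: "'a \<Rightarrow> 'b::euclidean_space"
  assumes "prob_space M" "integrable M f" "closed K" "convex K" "\<And>x. f x \<in> K"
  shows "(\<integral>x. f x \<partial>M) \<in> K"
proof (rule ccontr)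
  interpret prob_space M by fact
  assume "(\<integral>x. f x \<partial>M) \<notin> K"
  then obtain a b where ab: "a \<bullet> (\<integral>x. f x \<partial>M) < b" "\<And>y. y \<in> K \<Longrightarrow> b < a \<bullet> y"
    using separating_hyperplane_closed_point[OF assms(4,3)] by metis
  have "b = (\<integral>x. b \<partial>M)" by (simp add: prob_space)
  also have "\<dots> \<le> (\<integral>x. a \<bullet> f x \<partial>M)"
    using assms(2,5) ab(2) by (intro integral_mono) (auto intro: less_imp_le)
  also have "\<dots> = a \<bullet> (\<integral>x. f x \<partial>M)" using assms(2) by simp
  finally show False using ab(1) by simp
qed

text \<open>The indicator of a nonempty closed set is a bounded pointwise limit of continuous
  functions, so the measures agree on closed sets, which are stable under intersection and generate
  the Borel sets.\<close>

lemma measure_eqI_integral_bcontfun: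
  fixes \<mu> \<nu> :: "'a::metric_space measure"
  assumes "prob_space \<mu>" "prob_space \<nu>" "sets \<mu> = sets borel" "sets \<nu> = sets borel"
    and eq: "\<And>f :: 'a \<Rightarrow>\<^sub>C real. (\<integral>x. f x \<partial>\<mu>) = (\<integral>x. f x \<partial>\<nu>)"
  shows "\<mu> = \<nu>"
proof -
  have "measure \<mu> C = measure \<nu> C" if C: "closed C" "C \<noteq> {}" for C
  proof -
    define f where "f n x = max 0 (1 - real n * infdist x C)" for n and x :: 'a
    have f_cont: "continuous_on UNIV (f n)" for n
      unfolding f_def by (intro continuous_intros)
    have f_range: "0 \<le> f n x" "f n x \<le> 1" for n x
      by (auto simp: f_def infdist_nonneg)
    have f_lim: "(\<lambda>n. f n x) \<longlonglongrightarrow> indicat_real C x" for x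
    proof (cases "x \<in> C")
      case False
      then have "0 < infdist x C"
        using C infdist_nonneg[of x C] in_closed_iff_infdist_zero[of C x] by fastforce
      then obtain n where n: "1 \<le> real n * infdist x C"
        using reals_Archimedean3[of "infdist x C"] by (meson less_imp_le)
      have "f k x = 0" if "k \<ge> n" for k
      proof -
        have "real n * infdist x C \<le> real k * infdist x C"
          using that by (intro mult_right_mono) (auto simp: infdist_nonneg)
        with n show ?thesis by (simp add: f_def)
      qed
      with False show ?thesis by (intro tendsto_eventually) (auto simp: eventually_sequentially)
    qed (simp add: f_def)
    have "(\<lambda>n. \<integral>x. f n x \<partial>M) \<longlonglongrightarrow> measure M C"
      if "prob_space M" and M: "sets M = sets borel" for M :: "'a measure"
    proof -
      interpret prob_space M by fact
      have "C \<in> sets M" using C M by simp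
      have "(\<lambda>n. \<integral>x. f n x \<partial>M) \<longlonglongrightarrow> (\<integral>x. indicat_real C x \<partial>M)"
      proof (rule integral_dominated_convergence[where w="\<lambda>_. 1"])
        show "f n \<in> borel_measurable M" for n
          using borel_measurable_continuous_onI[OF f_cont] by (simp add: measurable_cong_sets[OF M refl])
      qed (use f_range f_lim \<open>C \<in> sets M\<close> in auto)
      with \<open>C \<in> sets M\<close> show ?thesis by simp
    qed
    from this[OF assms(1,3)] this[OF assms(2,4)]
    have "(\<lambda>n. \<integral>x. f n x \<partial>\<mu>) \<longlonglongrightarrow> measure \<mu> C" "(\<lambda>n. \<integral>x. f n x \<partial>\<nu>) \<longlonglongrightarrow> measure \<nu> C" .
    moreover have "(\<integral>x. f n x \<partial>\<mu>) = (\<integral>x. f n x \<partial>\<nu>)" for n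
    proof -
      have "f n \<in> bcontfun" using f_cont f_range by (intro bcontfun_normI[where b=1]) auto
      then show ?thesis using eq[of "Bcontfun (f n)"] by (simp add: Bcontfun_inverse)
    qed
    ultimately show ?thesis using LIMSEQ_unique by force
  qed
  then have "measure \<mu> C = measure \<nu> C" if "closed C" for C
    using that by (cases "C = {}") auto
  moreover have "finite_measure \<mu>" "finite_measure \<nu>"
    using assms(1,2) by (auto simp: prob_space_def)
  ultimately have em: "emeasure \<mu> C = emeasure \<nu> C" if "closed C" for C
    using that by (simp add: finite_measure.emeasure_eq_measure)
  show ?thesis
  proof (rule measure_eqI_generator_eq[where E="Collect closed" and \<Omega>=UNIV and A="\<lambda>_. UNIV"])
    show "emeasure \<mu> UNIV \<noteq> \<infinity>"
      using \<open>finite_measure \<mu>\<close> by (simp add: finite_measure.emeasure_finite)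
  qed (auto simp: Int_stable_def assms borel_eq_closed em)
qed

text \<open>As a set of functions it carries the product topology, that is, pointwise convergence of
  functionals, which is the weak-star topology.\<close>

definition means :: "(('a::topological_space \<Rightarrow>\<^sub>C real) \<Rightarrow> real) set" where
  "means = {\<Lambda>. (\<forall>f g. \<Lambda> (f + g) = \<Lambda> f + \<Lambda> g) \<and> (\<forall>c f. \<Lambda> (c *\<^sub>R f) = c * \<Lambda> f) \<and>
     (\<forall>f. (\<forall>x. 0 \<le> apply_bcontfun f x) \<longrightarrow> 0 \<le> \<Lambda> f) \<and> \<Lambda> (const_bcontfun 1) = 1}"

text \<open>The map along which \<open>weak_star_topology\<close> is pulled back.\<close>

definition integral_functional :: "'a::topological_space measure \<Rightarrow> ('a \<Rightarrow>\<^sub>C real) \<Rightarrow> real" where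
  "integral_functional \<mu> f = (\<integral>x. f x \<partial>\<mu>)"

lemma mean_represented_by_measure:
  fixes \<Lambda> :: "('a::metric_space \<Rightarrow>\<^sub>C real) \<Rightarrow> real"
  assumes compact: "compact (UNIV :: 'a set)" and "\<Lambda> \<in> means"
  obtains \<mu> where "sets \<mu> = sets borel" "prob_space \<mu>" "integral_functional \<mu> = \<Lambda>"
proof -
  note app = apply_Bcontfun_compact[OF compact]
  have \<Lambda>: "\<And>f g. \<Lambda> (f + g) = \<Lambda> f + \<Lambda> g" "\<And>c f. \<Lambda> (c *\<^sub>R f) = c * \<Lambda> f"
    "\<And>f. (\<And>x. 0 \<le> apply_bcontfun f x) \<Longrightarrow> 0 \<le> \<Lambda> f" "\<Lambda> (const_bcontfun 1) = 1"
    using assms(2) by (auto simp: means_def)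
  interpret mean_functional "\<lambda>f. \<Lambda> (Bcontfun f)"
  proof
    show "compact (UNIV :: 'a set)" by fact
  next
    fix f g :: "'a \<Rightarrow> real" assume "continuous_on UNIV f" "continuous_on UNIV g"
    then have "Bcontfun (\<lambda>x. f x + g x) = Bcontfun f + Bcontfun g"
      by (intro bcontfun_eqI) (simp add: app continuous_intros)
    then show "\<Lambda> (Bcontfun (\<lambda>x. f x + g x)) = \<Lambda> (Bcontfun f) + \<Lambda> (Bcontfun g)"
      by (simp add: \<Lambda>)
  next
    fix f :: "'a \<Rightarrow> real" and c assume "continuous_on UNIV f"
    then have "Bcontfun (\<lambda>x. c * f x) = c *\<^sub>R Bcontfun f"
      by (intro bcontfun_eqI) (simp add: app continuous_intros)
    then show "\<Lambda> (Bcontfun (\<lambda>x. c * f x)) = c * \<Lambda> (Bcontfun f)" by (simp add: \<Lambda>)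
  next
    fix f :: "'a \<Rightarrow> real" assume "continuous_on UNIV f" "\<And>x. 0 \<le> f x"
    then show "0 \<le> \<Lambda> (Bcontfun f)" by (intro \<Lambda>(3)) (simp add: app)
  next
    have "Bcontfun (\<lambda>_ :: 'a. 1) = const_bcontfun (1::real)"
      by (intro bcontfun_eqI) (simp add: app const_bcontfun.rep_eq)
    then show "\<Lambda> (Bcontfun (\<lambda>_. 1)) = 1" by (simp add: \<Lambda>)
  qed
  obtain \<mu> where \<mu>: "sets \<mu> = sets borel" "prob_space \<mu>"
    "\<And>f. continuous_on UNIV f \<Longrightarrow> (\<integral>x. f x \<partial>\<mu>) = \<Lambda> (Bcontfun f)"
    using riesz_representation by blast
  have "integral_functional \<mu> = \<Lambda>"
    by (auto simp: integral_functional_def \<mu>(3) apply_bcontfun_inverse)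
  with \<mu> show ?thesis using that by blast
qed

text \<open>Positivity applied to \<open>norm f\<close> plus or minus \<open>f\<close>.\<close>

lemma means_bound:
  assumes "\<Lambda> \<in> means"
  shows "\<bar>\<Lambda> f\<bar> \<le> norm f"
proof -
  have \<Lambda>: "\<And>f g. \<Lambda> (f + g) = \<Lambda> f + \<Lambda> g" "\<And>c f. \<Lambda> (c *\<^sub>R f) = c * \<Lambda> f"
    "\<And>f. (\<And>x. 0 \<le> apply_bcontfun f x) \<Longrightarrow> 0 \<le> \<Lambda> f" "\<Lambda> (const_bcontfun 1) = 1"
    using assms by (auto simp: means_def)
  have "0 \<le> norm f + s * \<Lambda> f" if "\<bar>s\<bar> = 1" for s
  proof -
    have "0 \<le> \<Lambda> (norm f *\<^sub>R const_bcontfun 1 + s *\<^sub>R f)"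
    proof (rule \<Lambda>(3))
      fix x
      have "\<bar>s * f x\<bar> \<le> norm f"
        using norm_bounded[of f x] that by (simp add: abs_mult)
      then show "0 \<le> apply_bcontfun (norm f *\<^sub>R const_bcontfun 1 + s *\<^sub>R f) x"
        by (simp add: const_bcontfun.rep_eq)
    qed
    then show ?thesis by (simp add: \<Lambda>)
  qed
  from this[of 1] this[of "-1"] show ?thesis by (simp add: abs_le_iff)
qed

lemma closed_means: "closed (means :: (('a::topological_space \<Rightarrow>\<^sub>C real) \<Rightarrow> real) set)"
  unfolding means_def
  by (intro closed_Collect_conj closed_Collect_all closed_Collect_eq closed_Collect_imp closed_Collect_le
      continuous_intros continuous_on_product_coordinates) auto

text \<open>The Banach-Alaoglu argument: a closed subset of a product of compact intervals.\<close>

lemma compact_means: "compact (means :: (('a::topological_space \<Rightarrow>\<^sub>C real) \<Rightarrow> real) set)"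
proof -
  have "compactin (product_topology (\<lambda>_. euclidean) UNIV)
      (\<Pi>\<^sub>E f\<in>UNIV. cball (0::real) (norm (f :: 'a \<Rightarrow>\<^sub>C real)))"
    by (simp add: compactin_PiE)
  then have "compact (\<Pi>\<^sub>E f\<in>UNIV. cball (0::real) (norm (f :: 'a \<Rightarrow>\<^sub>C real)))"
    by (simp add: euclidean_product_topology)
  moreover have "means \<subseteq> (\<Pi>\<^sub>E f\<in>UNIV. cball (0::real) (norm (f :: 'a \<Rightarrow>\<^sub>C real)))"
    using means_bound by auto
  ultimately show ?thesis
    using closed_means compact_Int_closed by (metis inf.absorb2)
qed

section \<open>Birkhoff averages and the vector-valued extension of functionals\<close>

definition birkhoff_average :: "('a \<Rightarrow> 'a) \<Rightarrow> nat \<Rightarrow> ('a \<Rightarrow> 'b::real_vector) \<Rightarrow> 'a \<Rightarrow> 'b" where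
  "birkhoff_average T n f x = (\<Sum>i<n. f ((T ^^ i) x)) /\<^sub>R real n"

lemma birkhoff_average_mem_convex:
  assumes "convex K" "\<And>x. f x \<in> K" "0 < n"
  shows "birkhoff_average T n f x \<in> K"
proof -
  have "(\<Sum>i<n. (1 / real n) *\<^sub>R f ((T ^^ i) x)) \<in> K"
    using assms by (intro convex_sum) auto
  then show ?thesis by (simp add: birkhoff_average_def scaleR_sum_right divide_inverse)
qed

text \<open>
  The extension of a functional to vector-valued functions, so that a functional given by a measure
  sends \<open>F\<close> to its integral.
\<close>

definition vector_functional :: "('a::topological_space \<Rightarrow> 'b::euclidean_space) \<Rightarrow> (('a \<Rightarrow>\<^sub>C real) \<Rightarrow> real) \<Rightarrow> 'b" where
  "vector_functional F \<Lambda> = (\<Sum>b\<in>Basis. \<Lambda> (Bcontfun (\<lambda>x. F x \<bullet> b)) *\<^sub>R b)"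

lemma continuous_on_vector_functional: "continuous_on UNIV (vector_functional F)"
  unfolding vector_functional_def by (intro continuous_intros continuous_on_product_coordinates)

lemma vector_functional_linear_combination:
  "vector_functional F (\<lambda>f. u * \<Lambda> f + v * \<Lambda>' f) = u *\<^sub>R vector_functional F \<Lambda> + v *\<^sub>R vector_functional F \<Lambda>'"
  by (simp add: vector_functional_def scaleR_sum_right sum.distrib scaleR_add_left)

locale compact_system =
  fixes T :: "'a::metric_space \<Rightarrow> 'a"
  assumes compact_space: "compact (UNIV :: 'a set)"
    and continuous: "continuous_on UNIV T"
begin

lemmas apply_Bcontfun = apply_Bcontfun_compact[OF compact_space]

lemma continuous_iterate: "continuous_on UNIV (T ^^ n)"
  by (induction n) (auto intro: continuous_on_compose2[OF continuous])

lemma continuous_birkhoff_average: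
  fixes f :: "'a \<Rightarrow> 'b::real_normed_vector"
  assumes "continuous_on UNIV f"
  shows "continuous_on UNIV (birkhoff_average T n f)"
  unfolding birkhoff_average_def
  by (intro continuous_intros continuous_on_compose2[OF assms continuous_iterate]) auto

lemma integrable_continuous:
  fixes f :: "'a \<Rightarrow> 'b::euclidean_space"
  assumes f: "continuous_on UNIV f" and "prob_space \<mu>" and sets: "sets \<mu> = sets borel"
  shows "integrable \<mu> f"
proof -
  interpret prob_space \<mu> by fact
  obtain B where B: "\<And>x. norm (f x) \<le> B"
    using compact_imp_bounded[OF compact_continuous_image[OF f compact_space]] by (auto simp: bounded_iff)
  have "f \<in> borel_measurable \<mu>"
    using borel_measurable_continuous_onI[OF f] by (simp add: measurable_cong_sets[OF sets refl])
  with B show ?thesis by (intro integrable_const_bound[of _ B]) auto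
qed

lemma invariant_measuresD:
  assumes "\<mu> \<in> invariant_measures T"
  shows "prob_space \<mu>" "sets \<mu> = sets borel" "distr \<mu> borel T = \<mu>"
  using assms by (auto simp: invariant_measures_def)

lemma integrable_invariant:
  fixes f :: "'a \<Rightarrow> 'b::euclidean_space"
  assumes "\<mu> \<in> invariant_measures T" "continuous_on UNIV f"
  shows "integrable \<mu> f"
  using assms invariant_measuresD integrable_continuous by blast

lemma integral_iterate:
  fixes f :: "'a \<Rightarrow> 'b::euclidean_space"
  assumes \<mu>: "\<mu> \<in> invariant_measures T" and f: "continuous_on UNIV f"
  shows "(\<integral>x. f ((T ^^ n) x) \<partial>\<mu>) = (\<integral>x. f x \<partial>\<mu>)"
proof (induction n)
  case (Suc n)
  note inv = invariant_measuresD[OF \<mu>]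
  let ?g = "\<lambda>x. f ((T ^^ n) x)"
  have g: "continuous_on UNIV ?g"
    by (intro continuous_on_compose2[OF f continuous_iterate]) auto
  have "(\<integral>x. ?g x \<partial>\<mu>) = (\<integral>x. ?g x \<partial>(distr \<mu> borel T))"
    by (simp add: inv)
  also have "\<dots> = (\<integral>x. ?g (T x) \<partial>\<mu>)"
    using borel_measurable_continuous_onI[OF continuous] borel_measurable_continuous_onI[OF g]
    by (intro integral_distr) (auto simp: measurable_cong_sets[OF inv(2) refl])
  finally show ?case using Suc by (simp add: funpow_swap1)
qed simp

text \<open>This is why a function may be traded for its averages without changing its rotation
  set.\<close>

lemma integral_birkhoff_average:
  fixes f :: "'a \<Rightarrow> 'b::euclidean_space"
  assumes \<mu>: "\<mu> \<in> invariant_measures T" and f: "continuous_on UNIV f" and "0 < n"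
  shows "(\<integral>x. birkhoff_average T n f x \<partial>\<mu>) = (\<integral>x. f x \<partial>\<mu>)"
proof -
  have "integrable \<mu> (\<lambda>x. f ((T ^^ i) x))" for i
    by (intro integrable_invariant[OF \<mu>] continuous_on_compose2[OF f continuous_iterate]) auto
  then show ?thesis
    using \<open>0 < n\<close> unfolding birkhoff_average_def
    by (simp add: Bochner_Integration.integral_sum integral_iterate[OF \<mu> f] sum_constant_scaleR del: sum_constant)
qed

lemma vector_functional_integral:
  fixes F :: "'a \<Rightarrow> 'b::euclidean_space"
  assumes \<mu>: "\<mu> \<in> invariant_measures T" and F: "continuous_on UNIV F"
  shows "vector_functional F (integral_functional \<mu>) = (\<integral>x. F x \<partial>\<mu>)"
proof (rule euclidean_eqI)
  fix b :: 'b assume b: "b \<in> Basis"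
  have "continuous_on UNIV (\<lambda>x. F x \<bullet> b)" using F by (intro continuous_intros)
  with b show "vector_functional F (integral_functional \<mu>) \<bullet> b = (\<integral>x. F x \<partial>\<mu>) \<bullet> b"
    using integrable_invariant[OF \<mu> F] unfolding vector_functional_def integral_functional_def
    by (simp add: inner_sum_left_Basis apply_Bcontfun F continuous_intros)
qed

text \<open>Reads the value of a vector-valued average at a point as the image of an empirical
  functional, so that compactness of the functionals controls such values.\<close>

lemma vector_functional_birkhoff_average:
  fixes F :: "'a \<Rightarrow> 'b::euclidean_space"
  assumes F: "continuous_on UNIV F"
  shows "vector_functional F (\<lambda>f. birkhoff_average T n (apply_bcontfun f) x) = birkhoff_average T n F x"
proof (rule euclidean_eqI)
  fix b :: 'b assume b: "b \<in> Basis"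
  then show "vector_functional F (\<lambda>f. birkhoff_average T n (apply_bcontfun f) x) \<bullet> b = birkhoff_average T n F x \<bullet> b"
    unfolding vector_functional_def birkhoff_average_def
    by (simp only: inner_sum_left_Basis)
      (simp add: apply_Bcontfun F continuous_intros inner_sum_left)
qed

section \<open>Invariant means as a compact model of the invariant measures\<close>

definition invariant_means :: "(('a \<Rightarrow>\<^sub>C real) \<Rightarrow> real) set" where
  "invariant_means = {\<Lambda> \<in> means. \<forall>f. \<Lambda> (Bcontfun (apply_bcontfun f \<circ> T)) = \<Lambda> f}"

lemma compact_invariant_means: "compact invariant_means"
proof -
  have "closed {\<Lambda> :: ('a \<Rightarrow>\<^sub>C real) \<Rightarrow> real. \<forall>f. \<Lambda> (Bcontfun (apply_bcontfun f \<circ> T)) = \<Lambda> f}"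
    by (intro closed_Collect_all closed_Collect_eq continuous_on_product_coordinates)
  then have "compact (means \<inter> {\<Lambda> :: ('a \<Rightarrow>\<^sub>C real) \<Rightarrow> real. \<forall>f. \<Lambda> (Bcontfun (apply_bcontfun f \<circ> T)) = \<Lambda> f})"
    by (intro compact_Int_closed compact_means)
  then show ?thesis by (simp add: invariant_means_def Int_def)
qed

lemma integral_functional_in_means:
  fixes \<mu> :: "'a measure"
  assumes "prob_space \<mu>" "sets \<mu> = sets borel"
  shows "integral_functional \<mu> \<in> means"
proof -
  interpret prob_space \<mu> by fact
  have "integrable \<mu> (apply_bcontfun f)" for f :: "'a \<Rightarrow>\<^sub>C real"
    using assms by (intro integrable_continuous) auto
  then show ?thesis
    by (auto simp: means_def integral_functional_def const_bcontfun.rep_eq prob_space)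
qed

text \<open>One inclusion is invariance of integrals. For the other, the Riesz theorem supplies a
  measure, and it is invariant because it and its image under \<open>T\<close> have the same
  integrals.\<close>

lemma integral_functional_invariant_measures:
  "integral_functional ` invariant_measures T = invariant_means"
proof (intro equalityI subsetI)
  fix \<Lambda> assume "\<Lambda> \<in> integral_functional ` invariant_measures T"
  then obtain \<mu> where \<mu>: "\<mu> \<in> invariant_measures T" "\<Lambda> = integral_functional \<mu>" by auto
  have "continuous_on UNIV (apply_bcontfun f \<circ> T)" for f :: "'a \<Rightarrow>\<^sub>C real"
    using continuous by (intro continuous_on_compose) auto
  then have "integral_functional \<mu> (Bcontfun (apply_bcontfun f \<circ> T)) = integral_functional \<mu> f" for f
    using integral_iterate[OF \<mu>(1), of f 1] by (simp add: integral_functional_def apply_Bcontfun)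
  then show "\<Lambda> \<in> invariant_means"
    using integral_functional_in_means invariant_measuresD[OF \<mu>(1)] \<mu>(2)
    by (auto simp: invariant_means_def)
next
  fix \<Lambda> assume \<Lambda>: "\<Lambda> \<in> invariant_means"
  then have "\<Lambda> \<in> means" by (simp add: invariant_means_def)
  then obtain \<mu> where \<mu>: "sets \<mu> = sets borel" "prob_space \<mu>" "integral_functional \<mu> = \<Lambda>"
    using mean_represented_by_measure[OF compact_space] by blast
  interpret prob_space \<mu> by fact
  have T_meas: "T \<in> measurable \<mu> borel"
    using borel_measurable_continuous_onI[OF continuous] by (simp add: measurable_cong_sets[OF \<mu>(1) refl])
  have "distr \<mu> borel T = \<mu>"
  proof (rule measure_eqI_integral_bcontfun)
    fix f :: "'a \<Rightarrow>\<^sub>C real"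
    have cont: "continuous_on UNIV (apply_bcontfun f \<circ> T)"
      using continuous by (intro continuous_on_compose) auto
    have "(\<integral>x. f x \<partial>distr \<mu> borel T) = (\<integral>x. f (T x) \<partial>\<mu>)"
      by (intro integral_distr T_meas borel_measurable_continuous_onI) auto
    also have "\<dots> = \<Lambda> (Bcontfun (apply_bcontfun f \<circ> T))"
      unfolding \<mu>(3)[symmetric] integral_functional_def by (subst apply_Bcontfun[OF cont]) (simp add: o_def)
    also have "\<dots> = (\<integral>x. f x \<partial>\<mu>)"
      using \<Lambda> unfolding invariant_means_def \<mu>(3)[symmetric] integral_functional_def by simp
    finally show "(\<integral>x. f x \<partial>distr \<mu> borel T) = (\<integral>x. f x \<partial>\<mu>)" .
  qed (use \<mu> prob_space_distr[OF T_meas] in auto)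
  with \<mu> show "\<Lambda> \<in> integral_functional ` invariant_measures T"
    by (auto simp: invariant_measures_def)
qed

lemma birkhoff_average_in_means:
  assumes "0 < n"
  shows "(\<lambda>f. birkhoff_average T n (apply_bcontfun f) x) \<in> means"
  using assms
  by (auto simp: means_def birkhoff_average_def const_bcontfun.rep_eq sum.distrib distrib_left
      sum_distrib_left[symmetric] intro!: mult_nonneg_nonneg sum_nonneg)

text \<open>The two sums telescope to the difference of their end terms.\<close>

lemma birkhoff_average_almost_invariant:
  fixes f :: "'a \<Rightarrow>\<^sub>C real"
  assumes "0 < n"
  shows "\<bar>birkhoff_average T n (apply_bcontfun f \<circ> T) x - birkhoff_average T n f x\<bar> \<le> 2 * norm f / real n"
proof -
  have "(\<Sum>i<n. f (T ((T ^^ i) x))) - (\<Sum>i<n. f ((T ^^ i) x)) = f ((T ^^ n) x) - f x"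
    using sum_lessThan_telescope[of "\<lambda>i. f ((T ^^ i) x)" n] by (simp add: sum_subtractf)
  moreover have "\<bar>f ((T ^^ n) x) - f x\<bar> \<le> 2 * norm f"
    using norm_bounded[of f x] norm_bounded[of f "(T ^^ n) x"] by (simp add: abs_le_iff)
  ultimately show ?thesis
    using assms unfolding birkhoff_average_def
    by (simp add: right_diff_distrib[symmetric] abs_mult field_simps)
qed

text \<open>The Krylov-Bogolyubov argument with a closed side condition: the almost invariant
  functionals in \<open>C\<close> form a decreasing sequence of closed sets that meet the compact
  set \<open>means\<close>. Taking \<open>C = UNIV\<close> gives existence; a set of bad functionals
  gives the uniform estimate on averages.\<close>

lemma invariant_mean_from_averages:
  assumes "closed C"
    and ex: "\<And>n. \<exists>m\<ge>n. \<exists>x. (\<lambda>f. birkhoff_average T m (apply_bcontfun f) x) \<in> C"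
  shows "invariant_means \<inter> C \<noteq> {}"
proof -
  define S where "S n = {\<Lambda> :: ('a \<Rightarrow>\<^sub>C real) \<Rightarrow> real.
    \<forall>f. \<bar>\<Lambda> (Bcontfun (apply_bcontfun f \<circ> T)) - \<Lambda> f\<bar> \<le> 2 * norm f / real (Suc n)} \<inter> C" for n
  have closed_S: "closed (S n)" for n
    unfolding S_def using \<open>closed C\<close>
    by (intro closed_Int closed_Collect_all closed_Collect_le continuous_intros continuous_on_product_coordinates)
  have anti: "S n \<subseteq> S m" if "m \<le> n" for m n
  proof -
    have "2 * norm f / real (Suc n) \<le> 2 * norm f / real (Suc m)" for f :: "'a \<Rightarrow>\<^sub>C real"
      using that by (intro divide_left_mono) auto
    then show ?thesis unfolding S_def by (auto intro: order_trans)
  qed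
  have "means \<inter> S n \<noteq> {}" for n
  proof -
    obtain m x where m: "m \<ge> Suc n" "(\<lambda>f. birkhoff_average T m (apply_bcontfun f) x) \<in> C"
      using ex by blast
    have "\<bar>birkhoff_average T m (apply_bcontfun (Bcontfun (apply_bcontfun f \<circ> T))) x - birkhoff_average T m f x\<bar>
        \<le> 2 * norm f / real (Suc n)" for f :: "'a \<Rightarrow>\<^sub>C real"
    proof -
      have "continuous_on UNIV (apply_bcontfun f \<circ> T)"
        using continuous by (intro continuous_on_compose) auto
      then have "\<bar>birkhoff_average T m (apply_bcontfun (Bcontfun (apply_bcontfun f \<circ> T))) x - birkhoff_average T m f x\<bar>
          \<le> 2 * norm f / real m"
        using birkhoff_average_almost_invariant[of m f x] m by (simp add: apply_Bcontfun)
      also have "\<dots> \<le> 2 * norm f / real (Suc n)"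
        using m by (intro divide_left_mono) auto
      finally show ?thesis .
    qed
    with m have "(\<lambda>f. birkhoff_average T m (apply_bcontfun f) x) \<in> S n" by (auto simp: S_def)
    with birkhoff_average_in_means[of m x] m show ?thesis by auto
  qed
  have "means \<inter> (\<Inter>n\<in>UNIV. S n) \<noteq> {}"
  proof (rule compact_imp_fip_image[OF compact_means])
    fix I :: "nat set" assume "finite I"
    \<comment> \<open>Inserting 0 gives \<open>Max\<close> a meaning when \<open>I\<close> is
      empty.\<close>
    then have "S (Max (insert 0 I)) \<subseteq> (\<Inter>n\<in>I. S n)"
      by (intro INT_greatest anti Max_ge) auto
    then show "means \<inter> (\<Inter>n\<in>I. S n) \<noteq> {}"
      using \<open>means \<inter> S (Max (insert 0 I)) \<noteq> {}\<close> by blast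
  qed (rule closed_S)
  then obtain \<Lambda> where \<Lambda>: "\<Lambda> \<in> means" "\<And>n. \<Lambda> \<in> S n" by auto
  have "\<Lambda> (Bcontfun (apply_bcontfun f \<circ> T)) = \<Lambda> f" for f
  proof -
    have "(\<lambda>n. 2 * norm f / real (Suc n)) \<longlonglongrightarrow> 0"
      using LIMSEQ_Suc[OF lim_const_over_n] by simp
    moreover have "\<bar>\<Lambda> (Bcontfun (apply_bcontfun f \<circ> T)) - \<Lambda> f\<bar> \<le> 2 * norm f / real (Suc n)" for n
      using \<Lambda>(2)[of n] by (simp add: S_def)
    ultimately have "\<bar>\<Lambda> (Bcontfun (apply_bcontfun f \<circ> T)) - \<Lambda> f\<bar> \<le> 0"
      by (intro LIMSEQ_le_const) auto
    then show ?thesis by simp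
  qed
  with \<Lambda> show ?thesis by (auto simp: invariant_means_def S_def)
qed

lemma invariant_means_nonempty: "invariant_means \<noteq> {}"
  using invariant_mean_from_averages[of UNIV] by auto

lemma convex_combination_invariant_means:
  assumes "\<Lambda> \<in> invariant_means" "\<Lambda>' \<in> invariant_means" "0 \<le> u" "0 \<le> v" "u + v = 1"
  shows "(\<lambda>f. u * \<Lambda> f + v * \<Lambda>' f) \<in> invariant_means"
  using assms by (auto simp: invariant_means_def means_def algebra_simps)

text \<open>The rotation set for plain functions, so that averages, projections and corrections need
  no wrapping as bounded continuous functions.\<close>

definition integrals :: "('a \<Rightarrow> 'b::euclidean_space) \<Rightarrow> 'b set" where
  "integrals F = (\<lambda>\<mu>. \<integral>x. F x \<partial>\<mu>) ` invariant_measures T"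

lemma rotation_set_eq_integrals: "rotation_set T F = integrals F"
  by (auto simp: rotation_set_def integrals_def)

lemma integrals_eq_vector_functional:
  assumes "continuous_on UNIV F"
  shows "integrals F = vector_functional F ` invariant_means"
  unfolding integrals_def integral_functional_invariant_measures[symmetric] image_image
  using vector_functional_integral[OF _ assms] by simp

text \<open>The set is the image of a nonempty compact convex set of functionals under a continuous
  map that respects convex combinations.\<close>

lemma integrals_convex_bodies:
  assumes F: "continuous_on UNIV F"
  shows "integrals F \<in> convex_bodies"
  unfolding convex_bodies_def
proof (intro CollectI conjI)
  show "integrals F \<noteq> {}"
    using invariant_means_nonempty by (simp add: integrals_eq_vector_functional[OF F])
  show "compact (integrals F)"
    unfolding integrals_eq_vector_functional[OF F]
    by (intro compact_continuous_image compact_invariant_means continuous_on_subset[OF continuous_on_vector_functional]) auto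
  show "convex (integrals F)"
  proof (rule convexI)
    fix x y and u v :: real
    assume "x \<in> integrals F" "y \<in> integrals F" and uv: "0 \<le> u" "0 \<le> v" "u + v = 1"
    then obtain \<Lambda> \<Lambda>' where \<Lambda>: "\<Lambda> \<in> invariant_means" "x = vector_functional F \<Lambda>"
      "\<Lambda>' \<in> invariant_means" "y = vector_functional F \<Lambda>'"
      by (auto simp: integrals_eq_vector_functional[OF F])
    have "u *\<^sub>R x + v *\<^sub>R y = vector_functional F (\<lambda>f. u * \<Lambda> f + v * \<Lambda>' f)"
      by (simp add: \<Lambda> vector_functional_linear_combination)
    then show "u *\<^sub>R x + v *\<^sub>R y \<in> integrals F"
      using convex_combination_invariant_means[OF \<Lambda>(1,3) uv] by (auto simp: integrals_eq_vector_functional[OF F])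
  qed
qed

text \<open>Otherwise every length has a point whose average is at least \<open>e\<close> away. The
  empirical functionals there lie in the closed set \<open>C\<close>, so some invariant mean lies in
  \<open>C\<close> too, although its value belongs to \<open>integrals F\<close>.\<close>

lemma birkhoff_average_close_to_integrals:
  fixes F :: "'a \<Rightarrow> 'b::euclidean_space"
  assumes F: "continuous_on UNIV F" and "0 < e"
  obtains n where "0 < n" "\<And>x. infdist (birkhoff_average T n F x) (integrals F) < e"
proof (rule ccontr)
  assume *: "\<not> thesis"
  define C where "C = {\<Lambda>. e \<le> infdist (vector_functional F \<Lambda>) (integrals F)}"
  have "closed C"
    unfolding C_def
    by (intro closed_Collect_le continuous_intros continuous_on_vector_functional)
  then have "invariant_means \<inter> C \<noteq> {}"
  proof (rule invariant_mean_from_averages)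
    fix n
    have "\<exists>x. \<not> infdist (birkhoff_average T (Suc n) F x) (integrals F) < e"
      using * that by blast
    then obtain x where "e \<le> infdist (birkhoff_average T (Suc n) F x) (integrals F)"
      by (auto simp: not_less)
    then have "(\<lambda>f. birkhoff_average T (Suc n) (apply_bcontfun f) x) \<in> C"
      by (simp add: C_def vector_functional_birkhoff_average[OF F])
    then show "\<exists>m\<ge>n. \<exists>x. (\<lambda>f. birkhoff_average T m (apply_bcontfun f) x) \<in> C"
      by (intro exI[of _ "Suc n"]) auto
  qed
  then obtain \<Lambda> where "\<Lambda> \<in> invariant_means" "e \<le> infdist (vector_functional F \<Lambda>) (integrals F)"
    by (auto simp: C_def)
  then show False
    using \<open>0 < e\<close> infdist_zero[of "vector_functional F \<Lambda>" "integrals F"] by (auto simp: integrals_eq_vector_functional[OF F])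
qed

end

section \<open>Periodic measures and realization of convex bodies\<close>

text \<open>Provides convergence of the absolutely summable series of corrections in
  \<open>realize_convex_body\<close>.\<close>

instance bcontfun :: (metric_space, banach) banach ..

text \<open>Lagrange interpolation with distances in place of linear factors, followed by projection
  onto a ball, which enforces the bound and fixes the prescribed values.\<close>

lemma finite_interpolation:
  fixes w :: "'a::metric_space \<Rightarrow> 'b::euclidean_space"
  assumes "finite A" "0 \<le> B" "\<And>y. y \<in> A \<Longrightarrow> norm (w y) \<le> B"
  obtains D where "continuous_on UNIV D" "\<And>y. y \<in> A \<Longrightarrow> D y = w y" "\<And>x. norm (D x) \<le> B"
proof -
  define bump where "bump y x = (\<Prod>z\<in>A - {y}. dist x z / dist y z)" for x y
  define L where "L x = (\<Sum>y\<in>A. bump y x *\<^sub>R w y)" for x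
  define D where "D x = closest_point (cball 0 B) (L x)" for x
  have ball: "convex (cball (0::'b) B)" "closed (cball (0::'b) B)" "cball (0::'b) B \<noteq> {}"
    using assms(2) by auto
  have "continuous_on UNIV L"
    unfolding L_def bump_def by (intro continuous_intros) auto
  then have "continuous_on UNIV D"
    unfolding D_def by (intro continuous_on_compose2[OF continuous_on_closest_point[OF ball, of UNIV]]) auto
  moreover have "D y = w y" if y: "y \<in> A" for y
  proof -
    have "bump z y = (if z = y then 1 else 0)" if "z \<in> A" for z
      using y assms(1) unfolding bump_def by (auto intro!: prod.neutral)
    then have "L y = (\<Sum>z\<in>A. if z = y then w z else 0)"
      unfolding L_def by (intro sum.cong) auto
    also have "\<dots> = w y" using y assms(1) by simp
    finally show ?thesis
      unfolding D_def using assms(3)[OF y] by (simp add: closest_point_self)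
  qed
  moreover have "norm (D x) \<le> B" for x
    using closest_point_in_set[OF ball(2,3), of "L x"] by (simp add: D_def)
  ultimately show ?thesis using that by blast
qed

lemma infdist_le_add_hausdorff_distance:
  assumes "K \<in> convex_bodies" "L \<in> convex_bodies"
  shows "infdist x K \<le> infdist x L + hausdorff_distance K L"
proof -
  have "closed L" "L \<noteq> {}" using assms by (auto simp: convex_bodies_def compact_imp_closed)
  then obtain y where "y \<in> L" "infdist x L = dist x y" using infdist_attains_inf by blast
  then show ?thesis
    using infdist_triangle[of x K y] infdist_le_hausdorff_distance[OF assms(2,1), of y]
    by (simp add: hausdorff_distance_commute)
qed

context compact_system
begin

lemma norm_integral_diff_le:
  fixes F G :: "'a \<Rightarrow> 'b::euclidean_space"
  assumes \<mu>: "\<mu> \<in> invariant_measures T" and FG: "continuous_on UNIV F" "continuous_on UNIV G"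
    and le: "\<And>x. norm (F x - G x) \<le> c"
  shows "norm ((\<integral>x. F x \<partial>\<mu>) - (\<integral>x. G x \<partial>\<mu>)) \<le> c"
proof -
  have "(\<integral>x. F x - G x \<partial>\<mu>) \<in> cball 0 c"
    using le invariant_measuresD[OF \<mu>] FG
    by (intro integral_mem_closed_convex integrable_invariant[OF \<mu>] continuous_intros) auto
  then show ?thesis using integrable_invariant[OF \<mu> FG(1)] integrable_invariant[OF \<mu> FG(2)] by simp
qed

text \<open>Each point of one set is matched with the integral of the other function against the
  same measure.\<close>

lemma hausdorff_distance_integrals_le:
  fixes F G :: "'a \<Rightarrow> 'b::euclidean_space"
  assumes FG: "continuous_on UNIV F" "continuous_on UNIV G" and le: "\<And>x. norm (F x - G x) \<le> c"
  shows "hausdorff_distance (integrals F) (integrals G) \<le> c"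
proof (rule hausdorff_distance_leI[OF integrals_convex_bodies[OF FG(1)] integrals_convex_bodies[OF FG(2)]])
  have *: "infdist x (integrals G) \<le> c"
    if "x \<in> integrals F" and FG: "continuous_on UNIV F" "continuous_on UNIV G" and le: "\<And>x. norm (F x - G x) \<le> c"
    for x and F G :: "'a \<Rightarrow> 'b"
  proof -
    obtain \<mu> where \<mu>: "\<mu> \<in> invariant_measures T" "x = (\<integral>x. F x \<partial>\<mu>)"
      using \<open>x \<in> integrals F\<close> by (auto simp: integrals_def)
    have "infdist x (integrals G) \<le> dist x (\<integral>x. G x \<partial>\<mu>)"
      using \<mu> by (intro infdist_le) (auto simp: integrals_def)
    also have "\<dots> \<le> c"
      unfolding \<mu>(2) dist_norm by (rule norm_integral_diff_le[OF \<mu>(1) FG le])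
    finally show ?thesis .
  qed
  show "infdist x (integrals G) \<le> c" if "x \<in> integrals F" for x
    using *[OF that FG le] .
  show "infdist x (integrals F) \<le> c" if "x \<in> integrals G" for x
    using *[OF that FG(2,1)] le by (simp add: norm_minus_commute)
qed

lemma integral_eq_const_on_support:
  fixes f :: "'a \<Rightarrow> 'b::euclidean_space"
  assumes \<mu>: "\<mu> \<in> invariant_measures T" and A: "measure \<mu> A = 1"
    and f: "continuous_on UNIV f" "\<And>y. y \<in> A \<Longrightarrow> f y = c"
  shows "(\<integral>x. f x \<partial>\<mu>) = c"
proof -
  note inv = invariant_measuresD[OF \<mu>]
  interpret prob_space \<mu> by (rule inv)
  \<comment> \<open>Non-measurable sets have \<open>measure\<close> 0, so the value 1 forces
    measurability.\<close>
  have "A \<in> sets \<mu>" using A measure_notin_sets by force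
  then have "AE x in \<mu>. x \<in> A" using A prob_eq_1 by blast
  then have "(\<integral>x. f x \<partial>\<mu>) = (\<integral>x. c \<partial>\<mu>)"
    using f integrable_invariant[OF \<mu> f(1)] by (intro integral_cong_AE) auto
  then show ?thesis by (simp add: prob_space)
qed

section \<open>Periodic orbits and their measures\<close>

lemma funpow_mult_fixed: "(T ^^ p) x = x \<Longrightarrow> p dvd n \<Longrightarrow> (T ^^ n) ((T ^^ j) x) = (T ^^ j) x"
proof -
  assume "(T ^^ p) x = x" "p dvd n"
  have "(T ^^ (p * k)) x = x" for k
    using \<open>(T ^^ p) x = x\<close> by (induction k) (simp_all add: funpow_add)
  then have "(T ^^ n) x = x" using \<open>p dvd n\<close> by (auto elim!: dvdE)
  then show ?thesis by (metis add.commute comp_apply funpow_add)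
qed

lemma finite_forward_orbit:
  assumes "periodic_point T x"
  shows "finite (forward_orbit T x)"
proof -
  obtain p where p: "0 < p" "(T ^^ p) x = x" using assms by (auto simp: periodic_point_def)
  have "forward_orbit T x \<subseteq> (\<lambda>j. (T ^^ j) x) ` {..<p}"
  proof
    fix y assume "y \<in> forward_orbit T x"
    then obtain j where "y = (T ^^ j) x" by (auto simp: forward_orbit_def)
    then have "y = (T ^^ (j mod p)) x" using funpow_mod_eq[OF p(2), of j] by simp
    then show "y \<in> (\<lambda>j. (T ^^ j) x) ` {..<p}" using p by auto
  qed
  then show ?thesis using finite_surj by blast
qed

text \<open>Averaging over a multiple of the period is unaffected by a shift along the orbit, so the
  average is constant there; this constant is its integral, which equals that of
  \<open>f\<close>.\<close>

lemma birkhoff_average_eq_integral: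
  fixes f :: "'a \<Rightarrow> 'b::euclidean_space"
  assumes \<mu>: "\<mu> \<in> invariant_measures T" and x: "measure \<mu> (forward_orbit T x) = 1"
    and p: "(T ^^ p) x = x" "p dvd n" "0 < n" and f: "continuous_on UNIV f"
    and y: "y \<in> forward_orbit T x"
  shows "birkhoff_average T n f y = (\<integral>x. f x \<partial>\<mu>)"
proof -
  have step: "birkhoff_average T n f (T z) = birkhoff_average T n f z" if "(T ^^ n) z = z" for z
  proof -
    have "(\<Sum>i<n. f ((T ^^ i) (T z))) - (\<Sum>i<n. f ((T ^^ i) z)) = f ((T ^^ n) z) - f z"
      using sum_lessThan_telescope[of "\<lambda>i. f ((T ^^ i) z)" n] by (simp add: sum_subtractf funpow_swap1)
    with that show ?thesis by (simp add: birkhoff_average_def)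
  qed
  have "birkhoff_average T n f ((T ^^ j) x) = birkhoff_average T n f x" for j
    by (induction j) (auto simp: step funpow_mult_fixed[OF p(1,2)])
  then have const: "birkhoff_average T n f z = birkhoff_average T n f x" if "z \<in> forward_orbit T x" for z
    using that by (auto simp: forward_orbit_def)
  have "(\<integral>x. f x \<partial>\<mu>) = (\<integral>x. birkhoff_average T n f x \<partial>\<mu>)"
    using integral_birkhoff_average[OF \<mu> f p(3)] by simp
  also have "\<dots> = birkhoff_average T n f x"
    using const by (intro integral_eq_const_on_support[OF \<mu> x] continuous_birkhoff_average f)
  finally show ?thesis using const[OF y] by simp
qed

text \<open>Both integrals equal the average at \<open>z\<close> over \<open>p * q\<close> steps. In
  contrapositive form: distinct periodic measures live on disjoint orbits.\<close>

lemma periodic_measures_eqI: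
  assumes \<mu>: "\<mu> \<in> invariant_measures T" "periodic_point T x" "measure \<mu> (forward_orbit T x) = 1"
    and \<nu>: "\<nu> \<in> invariant_measures T" "periodic_point T y" "measure \<nu> (forward_orbit T y) = 1"
    and z: "z \<in> forward_orbit T x" "z \<in> forward_orbit T y"
  shows "\<mu> = \<nu>"
proof -
  obtain p where p: "0 < p" "(T ^^ p) x = x" using \<mu>(2) by (auto simp: periodic_point_def)
  obtain q where q: "0 < q" "(T ^^ q) y = y" using \<nu>(2) by (auto simp: periodic_point_def)
  have "(\<integral>x. f x \<partial>\<mu>) = (\<integral>x. f x \<partial>\<nu>)" for f :: "'a \<Rightarrow>\<^sub>C real"
    using birkhoff_average_eq_integral[OF \<mu>(1,3) p(2), of "p * q" f z]
      birkhoff_average_eq_integral[OF \<nu>(1,3) q(2), of "p * q" f z] p q z by simp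
  then show ?thesis
    using invariant_measuresD \<mu>(1) \<nu>(1) by (intro measure_eqI_integral_bcontfun) auto
qed

end

section \<open>Approximation by distinct periodic measures\<close>

locale dense_periodic_system = compact_system +
  assumes not_uniquely_ergodic: "\<not> uniquely_ergodic T"
    and dense: "weak_star_topology T closure_of periodic_measures T = invariant_measures T"
begin

text \<open>Removing the finite set \<open>S\<close> keeps neighbourhoods weak-star open, so density
  applies at any invariant measure outside \<open>S\<close>. Failure of unique ergodicity supplies
  such a measure near \<open>\<nu>\<close>, even when \<open>\<nu>\<close> itself is in
  \<open>S\<close>.\<close>

lemma periodic_measure_near:
  fixes P :: "'a \<Rightarrow> 'b::euclidean_space"
  assumes \<nu>: "\<nu> \<in> invariant_measures T" and P: "continuous_on UNIV P" and "0 < e" and "finite S"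
  obtains \<mu> where "\<mu> \<in> periodic_measures T - S" "norm ((\<integral>x. P x \<partial>\<mu>) - (\<integral>x. P x \<partial>\<nu>)) < e"
proof -
  obtain \<omega> where \<omega>: "\<omega> \<in> invariant_measures T" "\<omega> \<noteq> \<nu>"
    using not_uniquely_ergodic \<nu> by (auto simp: uniquely_ergodic_def)
  have "\<exists>f. integral_functional \<omega> f \<noteq> integral_functional \<nu> f"
  proof (rule ccontr)
    assume "\<nexists>f. integral_functional \<omega> f \<noteq> integral_functional \<nu> f"
    then have "\<omega> = \<nu>"
      using invariant_measuresD[OF \<omega>(1)] invariant_measuresD[OF \<nu>]
      by (intro measure_eqI_integral_bcontfun) (simp_all add: integral_functional_def)
    with \<omega>(2) show False ..
  qed
  then obtain f where f: "integral_functional \<omega> f \<noteq> integral_functional \<nu> f" ..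
  \<comment> \<open>Moving \<open>\<nu>\<close> slightly along the segment towards \<open>\<omega>\<close> avoids the finite set \<open>S\<close>.\<close>
  let ?\<Lambda> = "\<lambda>t f. (1 - t) * integral_functional \<nu> f + t * integral_functional \<omega> f"
  let ?p = "\<integral>x. P x \<partial>\<nu>" and ?q = "\<integral>x. P x \<partial>\<omega>"
  \<comment> \<open>\<open>r \<le> 1\<close> keeps the combinations convex; the 1 in the denominator
    allows for \<open>?p = ?q\<close>.\<close>
  define r where "r = min 1 (e / (1 + norm (?q - ?p)))"
  have r: "0 < r" "r \<le> 1" "r * norm (?q - ?p) < e"
  proof -
    have pos: "0 < 1 + norm (?q - ?p)" by (simp add: add_pos_nonneg)
    then show "0 < r" "r \<le> 1" using \<open>0 < e\<close> by (auto simp: r_def)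
    have "r * norm (?q - ?p) < r * (1 + norm (?q - ?p))" using \<open>0 < r\<close> by simp
    also have "\<dots> \<le> e / (1 + norm (?q - ?p)) * (1 + norm (?q - ?p))"
      using pos by (intro mult_right_mono) (auto simp: r_def)
    also have "\<dots> = e" using pos by simp
    finally show "r * norm (?q - ?p) < e" .
  qed
  \<comment> \<open>The function \<open>f\<close> tells the two endpoints apart, so the segment
    contains infinitely many functionals and cannot lie in the finite image of
    \<open>S\<close>.\<close>
  have "inj_on ?\<Lambda> {0<..<r}"
  proof (rule inj_onI)
    fix s t assume "?\<Lambda> s = ?\<Lambda> t"
    from fun_cong[OF this, of f]
    have "(s - t) * (integral_functional \<omega> f - integral_functional \<nu> f) = 0" by (simp add: algebra_simps)
    with f show "s = t" by simp
  qed
  then have "infinite (?\<Lambda> ` {0<..<r})" using r by (simp add: finite_image_iff infinite_Ioo)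
  then have "\<not> ?\<Lambda> ` {0<..<r} \<subseteq> integral_functional ` S"
    using \<open>finite S\<close> by (meson finite_imageI finite_subset)
  then have "\<exists>t\<in>{0<..<r}. ?\<Lambda> t \<notin> integral_functional ` S" by blast
  then obtain t where "t \<in> {0<..<r}" and t: "?\<Lambda> t \<notin> integral_functional ` S" ..
  then have t01: "0 < t" "t < r" by simp_all
  have "?\<Lambda> t \<in> invariant_means"
    using \<nu> \<omega>(1) t01 r(2) unfolding integral_functional_invariant_measures[symmetric]
    by (intro convex_combination_invariant_means[unfolded integral_functional_invariant_measures[symmetric]]) auto
  then obtain \<nu>' where \<nu>': "?\<Lambda> t = integral_functional \<nu>'" "\<nu>' \<in> invariant_measures T"
    unfolding integral_functional_invariant_measures[symmetric] by (rule imageE)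
  \<comment> \<open>Open for pointwise convergence, because finite sets of functionals are closed;
    its preimage is the neighbourhood to which density is applied.\<close>
  define U where "U = {\<Lambda>. norm (vector_functional P \<Lambda> - ?p) < e} \<inter> - integral_functional ` S"
  have "integral_functional ` S = (\<Union>\<sigma>\<in>S. {\<Lambda>. \<forall>f. \<Lambda> f = integral_functional \<sigma> f})"
    by (auto simp: fun_eq_iff)
  also have "closed \<dots>"
    using \<open>finite S\<close>
    by (intro closed_UN ballI closed_Collect_all closed_Collect_eq continuous_on_product_coordinates continuous_on_const)
  finally have "open U"
    unfolding U_def
    by (intro open_Int open_Collect_less continuous_intros continuous_on_vector_functional open_Compl)
  then have "openin (product_topology (\<lambda>_. euclideanreal) UNIV) U"
    by (simp add: euclidean_product_topology)
  then have "openin (weak_star_topology T) (integral_functional -` U \<inter> invariant_measures T)"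
    unfolding weak_star_topology_def openin_pullback_topology 
    by (intro exI[of _ U]) (auto simp: integral_functional_def[abs_def])
  moreover have "\<nu>' \<in> integral_functional -` U \<inter> invariant_measures T"
  proof -
    have "vector_functional P (?\<Lambda> t) - ?p = t *\<^sub>R (?q - ?p)"
      unfolding vector_functional_linear_combination vector_functional_integral[OF \<nu> P] vector_functional_integral[OF \<omega>(1) P]
      by (simp add: algebra_simps)
    moreover have "t * norm (?q - ?p) \<le> r * norm (?q - ?p)" using t01 by (intro mult_right_mono) auto
    ultimately have "norm (vector_functional P (?\<Lambda> t) - ?p) < e" using t01 r by simp
    then show ?thesis using \<nu>'(2) t unfolding vimage_def U_def \<nu>'(1) by simp
  qed
  ultimately have V: "\<nu>' \<in> integral_functional -` U \<inter> invariant_measures T \<and>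
      openin (weak_star_topology T) (integral_functional -` U \<inter> invariant_measures T)" by simp
  have "\<nu>' \<in> weak_star_topology T closure_of periodic_measures T"
    using dense \<nu>'(2) by simp
  from this[unfolded in_closure_of, THEN conjunct2, rule_format, OF V]
  obtain \<mu> where \<mu>: "\<mu> \<in> periodic_measures T" "\<mu> \<in> integral_functional -` U \<inter> invariant_measures T"
    by auto
  then have "norm ((\<integral>x. P x \<partial>\<mu>) - ?p) < e" "\<mu> \<notin> S"
    using vector_functional_integral[OF _ P, of \<mu>] by (auto simp: U_def)
  with \<mu> show ?thesis using that by blast
qed

text \<open>Chosen one at a time, each avoiding the finitely many earlier ones.\<close>

lemma periodic_measures_near:
  fixes P :: "'a \<Rightarrow> 'b::euclidean_space"
  assumes "finite I" and P: "continuous_on UNIV P" and "0 < e"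
    and "\<And>i. i \<in> I \<Longrightarrow> \<nu> i \<in> invariant_measures T"
  obtains \<mu> where "inj_on \<mu> I" "\<And>i. i \<in> I \<Longrightarrow> \<mu> i \<in> periodic_measures T"
    "\<And>i. i \<in> I \<Longrightarrow> norm ((\<integral>x. P x \<partial>\<mu> i) - (\<integral>x. P x \<partial>\<nu> i)) < e"
proof -
  have "\<exists>\<mu>. inj_on \<mu> I \<and> (\<forall>i\<in>I. \<mu> i \<in> periodic_measures T \<and> norm ((\<integral>x. P x \<partial>\<mu> i) - (\<integral>x. P x \<partial>\<nu> i)) < e)"
    using assms(1,4)
  proof (induction I rule: finite_induct)
    case (insert j I)
    then obtain \<mu> where \<mu>: "inj_on \<mu> I"
      "\<forall>i\<in>I. \<mu> i \<in> periodic_measures T \<and> norm ((\<integral>x. P x \<partial>\<mu> i) - (\<integral>x. P x \<partial>\<nu> i)) < e" by auto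
    obtain m where m: "m \<in> periodic_measures T - \<mu> ` I" "norm ((\<integral>x. P x \<partial>m) - (\<integral>x. P x \<partial>\<nu> j)) < e"
      using periodic_measure_near[OF _ P \<open>0 < e\<close>, of "\<nu> j" "\<mu> ` I"] insert by auto
    have "inj_on (\<mu>(j := m)) (insert j I)"
      using m \<mu> insert(2) by (auto simp: inj_on_def)
    moreover have "\<forall>i\<in>insert j I. (\<mu>(j := m)) i \<in> periodic_measures T \<and>
        norm ((\<integral>x. P x \<partial>(\<mu>(j := m)) i) - (\<integral>x. P x \<partial>\<nu> i)) < e"
      using m \<mu> insert(2) by auto
    ultimately show ?case by blast
  qed simp
  then show ?thesis using that by blast
qed

text \<open>The cost \<open>3 * d\<close> is \<open>d\<close> for projecting the Birkhoff average
  and \<open>2 * d\<close> for correcting on periodic orbits. The precision \<open>e\<close> is only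
  the mesh of the net, hence independent of \<open>d\<close>; this makes the iteration
  converge.\<close>

lemma approximate_convex_body:
  fixes F :: "'a \<Rightarrow> 'b::euclidean_space"
  assumes K: "K \<in> convex_bodies" and F: "continuous_on UNIV F"
    and close: "hausdorff_distance K (integrals F) < d" and "0 < e"
  obtains G where "continuous_on UNIV G" "\<And>x. norm (G x - F x) \<le> 3 * d"
    "hausdorff_distance K (integrals G) \<le> e"
proof -
  have K': "convex K" "closed K" "K \<noteq> {}" "compact K"
    using K by (auto simp: convex_bodies_def compact_imp_closed)
  have proj: "continuous_on UNIV (closest_point K)" by (rule continuous_on_closest_point[OF K'(1-3)])
  \<comment> \<open>The strict hypothesis leaves the slack \<open>d - h\<close>, spent once on the
    Birkhoff average and once on the periodic measures.\<close>
  define h where "h = hausdorff_distance K (integrals F)"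
  have "0 < d - h" "0 \<le> h" using close hausdorff_distance_nonneg[of K "integrals F"] by (auto simp: h_def)
  note RF = integrals_convex_bodies[OF F]
  obtain N where N: "0 < N" "\<And>x. infdist (birkhoff_average T N F x) (integrals F) < d - h"
    using birkhoff_average_close_to_integrals[OF F \<open>0 < d - h\<close>] by blast
  let ?F = "birkhoff_average T N F"
  have F': "continuous_on UNIV ?F" by (rule continuous_birkhoff_average[OF F])
  define P where "P x = closest_point K (?F x)" for x
  have P: "continuous_on UNIV P"
    unfolding P_def by (intro continuous_on_compose2[OF proj F']) auto
  have P_K: "P x \<in> K" for x
    unfolding P_def by (rule closest_point_in_set[OF K'(2,3)])
  have P_F': "norm (P x - ?F x) \<le> d" for x
  proof -
    have "norm (P x - ?F x) = infdist (?F x) K"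
      using setdist_closest_point[OF K'(2,3), of "?F x"]
      by (simp add: P_def infdist_eq_setdist dist_norm norm_minus_commute)
    also have "\<dots> \<le> infdist (?F x) (integrals F) + h"
      unfolding h_def by (rule infdist_le_add_hausdorff_distance[OF K RF])
    finally show ?thesis using N(2)[of x] by simp
  qed
  have "K \<subseteq> (\<Union>k\<in>K. ball k e)" using \<open>0 < e\<close> by auto
  then obtain C where C: "C \<subseteq> K" "finite C" "K \<subseteq> (\<Union>k\<in>C. ball k e)"
    by (rule compactE_image[OF K'(4) open_ball])
  \<comment> \<open>A point of \<open>integrals F\<close> nearest to \<open>k\<close> is within
    \<open>h\<close>; passing from \<open>F\<close> to \<open>P\<close> moves its integral by at
    most \<open>d\<close>, since \<open>?F\<close> and \<open>F\<close> have equal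
    integrals.\<close>
  have "\<exists>\<nu>. \<nu> \<in> invariant_measures T \<and> norm ((\<integral>x. P x \<partial>\<nu>) - k) \<le> h + d" if "k \<in> C" for k
  proof -
    have "closed (integrals F)" "integrals F \<noteq> {}"
      using RF by (auto simp: convex_bodies_def compact_imp_closed)
    then obtain r where r: "r \<in> integrals F" "infdist k (integrals F) = dist k r"
      using infdist_attains_inf[of "integrals F" k] by auto
    then obtain \<nu> where \<nu>: "\<nu> \<in> invariant_measures T" "r = (\<integral>x. F x \<partial>\<nu>)" by (auto simp: integrals_def)
    have "norm ((\<integral>x. P x \<partial>\<nu>) - r) \<le> d"
      using norm_integral_diff_le[OF \<nu>(1) P F' P_F'] integral_birkhoff_average[OF \<nu>(1) F N(1)] \<nu>(2) by simp
    moreover have "dist k r \<le> h"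
      using infdist_le_hausdorff_distance[OF K RF, of k] r C \<open>k \<in> C\<close> by (auto simp: h_def)
    moreover have "norm ((\<integral>x. P x \<partial>\<nu>) - k) \<le> norm ((\<integral>x. P x \<partial>\<nu>) - r) + dist k r"
      using norm_triangle_ineq[of "(\<integral>x. P x \<partial>\<nu>) - r" "r - k"] by (simp add: dist_norm norm_minus_commute)
    ultimately show ?thesis using \<nu> by force
  qed
  then obtain \<nu> where \<nu>: "\<And>k. k \<in> C \<Longrightarrow> \<nu> k \<in> invariant_measures T"
    "\<And>k. k \<in> C \<Longrightarrow> norm ((\<integral>x. P x \<partial>\<nu> k) - k) \<le> h + d" by metis
  obtain \<mu> where inj: "inj_on \<mu> C" and per: "\<And>k. k \<in> C \<Longrightarrow> \<mu> k \<in> periodic_measures T"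
    and near: "\<And>k. k \<in> C \<Longrightarrow> norm ((\<integral>x. P x \<partial>\<mu> k) - (\<integral>x. P x \<partial>\<nu> k)) < d - h"
    using periodic_measures_near[OF C(2) P \<open>0 < d - h\<close>, of \<nu>] \<nu>(1) by blast
  have \<mu>_inv: "\<mu> k \<in> invariant_measures T" if "k \<in> C" for k
    using per[OF that] by (simp add: periodic_measures_def)
  have k_near: "norm (k - (\<integral>x. P x \<partial>\<mu> k)) \<le> 2 * d" if "k \<in> C" for k
    using \<nu>(2)[OF that] near[OF that]
      norm_triangle_ineq[of "(\<integral>x. P x \<partial>\<mu> k) - (\<integral>x. P x \<partial>\<nu> k)" "(\<integral>x. P x \<partial>\<nu> k) - k"]
    by (simp add: norm_minus_commute)
  have "\<exists>x. periodic_point T x \<and> measure (\<mu> k) (forward_orbit T x) = 1" if "k \<in> C" for k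
    using per[OF that] by (simp add: periodic_measures_def)
  then obtain pt where pt: "\<And>k. k \<in> C \<Longrightarrow> periodic_point T (pt k)"
    "\<And>k. k \<in> C \<Longrightarrow> measure (\<mu> k) (forward_orbit T (pt k)) = 1"
    by metis
  have "\<exists>p. 0 < p \<and> (T ^^ p) (pt k) = pt k" if "k \<in> C" for k
    using pt(1)[OF that] by (simp add: periodic_point_def)
  then obtain per where per: "\<And>k. k \<in> C \<Longrightarrow> 0 < per k" "\<And>k. k \<in> C \<Longrightarrow> (T ^^ per k) (pt k) = pt k"
    by metis
  \<comment> \<open>A common multiple of all the periods.\<close>
  define M where "M = (\<Prod>k\<in>C. per k)"
  have "0 < M" unfolding M_def using per(1) by (intro prod_pos) auto
  define Q where "Q = birkhoff_average T M P"
  have Q: "continuous_on UNIV Q" unfolding Q_def by (rule continuous_birkhoff_average[OF P])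
  have Q_K: "Q x \<in> K" for x
    unfolding Q_def by (rule birkhoff_average_mem_convex[OF K'(1) P_K \<open>0 < M\<close>])
  have Q_orbit: "Q y = (\<integral>x. P x \<partial>\<mu> k)" if "k \<in> C" "y \<in> forward_orbit T (pt k)" for k y
    unfolding Q_def
    by (rule birkhoff_average_eq_integral[OF \<mu>_inv pt(2) per(2) _ \<open>0 < M\<close> P])
      (use that C(2) in \<open>auto simp: M_def intro: dvd_prodI\<close>)
  define A where "A = (\<Union>k\<in>C. forward_orbit T (pt k))"
  have "\<forall>y\<in>A. \<exists>k. k \<in> C \<and> y \<in> forward_orbit T (pt k)" by (auto simp: A_def)
  then obtain \<kappa> where \<kappa>: "\<And>y. y \<in> A \<Longrightarrow> \<kappa> y \<in> C" "\<And>y. y \<in> A \<Longrightarrow> y \<in> forward_orbit T (pt (\<kappa> y))"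
    by metis
  \<comment> \<open>The label of an orbit point is unambiguous: a shared point would identify the
    two measures, and \<open>\<mu>\<close> is injective on \<open>C\<close>.\<close>
  have \<kappa>_eq: "\<kappa> y = k" if "k \<in> C" "y \<in> forward_orbit T (pt k)" for k y
  proof -
    have "y \<in> A" using that by (auto simp: A_def)
    then have "\<mu> (\<kappa> y) = \<mu> k"
      using \<kappa> that pt \<mu>_inv by (intro periodic_measures_eqI[of _ "pt (\<kappa> y)" _ "pt k" y]) auto
    then show ?thesis using inj \<kappa>(1) \<open>y \<in> A\<close> \<open>k \<in> C\<close> by (auto dest: inj_onD)
  qed
  have "finite A" unfolding A_def using C(2) pt(1) by (auto intro: finite_forward_orbit)
  moreover have "norm (\<kappa> y - Q y) \<le> 2 * d" if "y \<in> A" for y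
    using k_near[OF \<kappa>(1)[OF that]] Q_orbit[OF \<kappa>(1)[OF that] \<kappa>(2)[OF that]] by simp
  ultimately obtain D where D: "continuous_on UNIV D" "\<And>y. y \<in> A \<Longrightarrow> D y = \<kappa> y - Q y" "\<And>x. norm (D x) \<le> 2 * d"
    using finite_interpolation[of A "2 * d" "\<lambda>y. \<kappa> y - Q y"] \<open>0 < d - h\<close> \<open>0 \<le> h\<close>
    by auto
  \<comment> \<open>Projection restores values in \<open>K\<close> and keeps the net points reached
    on the orbits. It is nonexpansive and fixes \<open>Q x\<close>, so the bound
    \<open>2 * d\<close> survives.\<close>
  define G' where "G' x = closest_point K (Q x + D x)" for x
  have G': "continuous_on UNIV G'"
    unfolding G'_def using Q D(1) by (intro continuous_on_compose2[OF proj] continuous_intros) auto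
  have G'_K: "G' x \<in> K" for x
    unfolding G'_def by (rule closest_point_in_set[OF K'(2,3)])
  have G'_Q: "norm (G' x - Q x) \<le> 2 * d" for x
    using closest_point_lipschitz[OF K'(1-3), of "Q x + D x" "Q x"] D(3)[of x] closest_point_self[OF Q_K, of x]
    by (simp add: G'_def dist_norm)
  have G'_orbit: "G' y = k" if "k \<in> C" "y \<in> forward_orbit T (pt k)" for k y
  proof -
    have "y \<in> A" using that by (auto simp: A_def)
    then show ?thesis using D(2) \<kappa>_eq[OF that] that C(1) by (auto simp: G'_def closest_point_self)
  qed
  \<comment> \<open>Integrals of \<open>F\<close> and \<open>?F\<close> cancel, as do those of
    \<open>P\<close> and \<open>Q\<close>, so \<open>G\<close> has the integrals of
    \<open>G'\<close>. Both added differences are uniformly small, whereas \<open>G'\<close> itself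
    need not be near \<open>F\<close>.\<close>
  define G where "G x = F x + (P x - ?F x) + (G' x - Q x)" for x
  have G: "continuous_on UNIV G"
    unfolding G_def by (intro continuous_intros F P F' G' Q)
  have G_G': "(\<integral>x. G x \<partial>m) = (\<integral>x. G' x \<partial>m)" if m: "m \<in> invariant_measures T" for m
  proof -
    note int = integrable_invariant[OF m]
    have "(\<integral>x. G x \<partial>m) = (\<integral>x. F x \<partial>m) + ((\<integral>x. P x \<partial>m) - (\<integral>x. ?F x \<partial>m)) + ((\<integral>x. G' x \<partial>m) - (\<integral>x. Q x \<partial>m))"
      unfolding G_def by (simp add: int F P F' G' Q)
    then show ?thesis
      using integral_birkhoff_average[OF m F N(1)] integral_birkhoff_average[OF m P \<open>0 < M\<close>]
      by (simp add: Q_def)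
  qed
  show thesis
  proof
    show "continuous_on UNIV G" by (rule G)
    show "norm (G x - F x) \<le> 3 * d" for x
      using norm_triangle_ineq[of "P x - ?F x" "G' x - Q x"] P_F'[of x] G'_Q[of x] by (simp add: G_def)
    show "hausdorff_distance K (integrals G) \<le> e"
    proof (rule hausdorff_distance_leI[OF K integrals_convex_bodies[OF G]])
      fix y assume "y \<in> K"
      then obtain k where k: "k \<in> C" "dist k y < e" using C(3) by auto
      have "k = (\<integral>x. G x \<partial>\<mu> k)"
        using integral_eq_const_on_support[OF \<mu>_inv pt(2) G' G'_orbit] G_G' \<mu>_inv k(1) by auto
      then have "k \<in> integrals G" using \<mu>_inv k(1) by (auto simp: integrals_def)
      from infdist_le[OF this, of y] show "infdist y (integrals G) \<le> e"
        using k(2) by (simp add: dist_commute)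
    next
      fix y assume "y \<in> integrals G"
      then obtain m where m: "m \<in> invariant_measures T" "y = (\<integral>x. G' x \<partial>m)"
        using G_G' by (auto simp: integrals_def)
      then have "y \<in> K"
        using integral_mem_closed_convex[OF invariant_measuresD(1)[OF m(1)] integrable_invariant[OF m(1) G'] K'(2,1) G'_K] by simp
      then show "infdist y K \<le> e" using \<open>0 < e\<close> by simp
    qed
  qed
qed

text \<open>The factor 6 is the sum of the steps \<open>3 * (d / 2 ^ n)\<close>. The limit has
  rotation set \<open>K\<close> by the Lipschitz bound and because distance zero between convex
  bodies means equality.\<close>

lemma realize_convex_body:
  fixes F :: "'a \<Rightarrow>\<^sub>C 'b::euclidean_space"
  assumes K: "K \<in> convex_bodies" and close: "hausdorff_distance K (integrals F) < d"
  obtains G :: "'a \<Rightarrow>\<^sub>C 'b" where "dist F G \<le> 6 * d" "integrals G = K"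
proof -
  have "0 < d" using close hausdorff_distance_nonneg[of K "integrals F"] by linarith
  have step: "\<exists>G'. hausdorff_distance K (integrals (apply_bcontfun G')) < d / 2 ^ Suc n \<and> norm (G' - G) \<le> 3 * (d / 2 ^ n)"
    if G: "hausdorff_distance K (integrals (apply_bcontfun G)) < d / 2 ^ n" for n and G :: "'a \<Rightarrow>\<^sub>C 'b"
  proof -
    \<comment> \<open>Precision \<open>d / 2 ^ Suc (Suc n)\<close> turns the weak inequality
      obtained into the strict one \<open>< d / 2 ^ Suc n\<close> required to continue.\<close>
    obtain H where H: "continuous_on UNIV H" "\<And>x. norm (H x - G x) \<le> 3 * (d / 2 ^ n)"
      "hausdorff_distance K (integrals H) \<le> d / 2 ^ Suc (Suc n)"
      using approximate_convex_body[OF K continuous_on_apply_bcontfun G, of "d / 2 ^ Suc (Suc n)"] \<open>0 < d\<close> by auto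
    have "norm (Bcontfun H - G) \<le> 3 * (d / 2 ^ n)"
      using H(1,2) by (intro norm_bound) (simp add: apply_Bcontfun)
    moreover have "d / 2 ^ Suc (Suc n) < d / 2 ^ Suc n" using \<open>0 < d\<close> by (simp add: field_simps)
    ultimately show ?thesis using H by (intro exI[of _ "Bcontfun H"]) (simp add: apply_Bcontfun)
  qed
  \<comment> \<open>The clause about \<open>n = 0\<close> pins the start of the chosen sequence to
    \<open>F\<close>.\<close>
  have "\<exists>g. \<forall>n. (hausdorff_distance K (integrals (apply_bcontfun (g n))) < d / 2 ^ n \<and> (n = 0 \<longrightarrow> g n = F))
      \<and> norm (g (Suc n) - g n) \<le> 3 * (d / 2 ^ n)"
  proof (rule dependent_nat_choice)
    show "\<exists>G. hausdorff_distance K (integrals (apply_bcontfun G)) < d / 2 ^ 0 \<and> ((0::nat) = 0 \<longrightarrow> G = F)"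
      using close by auto
  next
    fix G n
    assume "hausdorff_distance K (integrals (apply_bcontfun G)) < d / 2 ^ n \<and> (n = 0 \<longrightarrow> G = F)"
    then show "\<exists>G'. (hausdorff_distance K (integrals (apply_bcontfun G')) < d / 2 ^ Suc n \<and> (Suc n = 0 \<longrightarrow> G' = F))
      \<and> norm (G' - G) \<le> 3 * (d / 2 ^ n)"
      using step[of G n] by auto
  qed
  then obtain g :: "nat \<Rightarrow> 'a \<Rightarrow>\<^sub>C 'b" where g0: "g 0 = F"
    and g: "\<And>n. hausdorff_distance K (integrals (g n)) < d / 2 ^ n"
    and gS: "\<And>n. norm (g (Suc n) - g n) \<le> 3 * (d / 2 ^ n)"
    by auto
  have geo: "(\<lambda>n. 3 * (d / 2 ^ n)) sums (6 * d)"
  proof -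
    have "(\<lambda>n. (6 * d) * (1/2) ^ Suc n) sums ((6 * d) * 1)"
      by (intro sums_mult power_half_series)
    moreover have "(6 * d) * (1/2) ^ Suc n = 3 * (d / 2 ^ n)" for n
      by (simp add: power_one_over field_simps)
    ultimately show ?thesis by (simp only: mult_1_right)
  qed
  have summ: "summable (\<lambda>n. norm (g (Suc n) - g n))"
    by (rule summable_comparison_test'[OF sums_summable[OF geo], of 0]) (simp only: real_norm_def abs_norm_cancel gS)
  \<comment> \<open>The limit of \<open>g\<close>, written as a telescoping series to obtain its
    distance from \<open>F\<close>.\<close>
  define G where "G = F + (\<Sum>n. g (Suc n) - g n)"
  have "(\<lambda>n. \<Sum>i<n. g (Suc i) - g i) \<longlonglongrightarrow> G - F"
    using summable_LIMSEQ[OF summable_norm_cancel[OF summ]] by (simp add: G_def)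
  then have "(\<lambda>n. g n - F) \<longlonglongrightarrow> G - F" by (simp only: sum_lessThan_telescope g0)
  from tendsto_add[OF this tendsto_const[of F]] have lim: "g \<longlonglongrightarrow> G" by simp
  have "norm (G - F) \<le> (\<Sum>n. norm (g (Suc n) - g n))"
    unfolding G_def by (simp add: summable_norm[OF summ])
  also have "\<dots> \<le> 6 * d"
    unfolding sums_unique[OF geo] by (rule suminf_le[OF gS summ sums_summable[OF geo]])
  finally have "dist F G \<le> 6 * d" by (simp add: dist_norm norm_minus_commute)
  interpret CB: Metric_space "convex_bodies :: 'b set set" hausdorff_distance
    by (rule Metric_space_convex_bodies)
  have RG: "integrals H \<in> convex_bodies" for H :: "'a \<Rightarrow>\<^sub>C 'b"
    by (rule integrals_convex_bodies) simp
  have bound: "hausdorff_distance K (integrals G) \<le> d / 2 ^ n + dist (g n) G" for n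
  proof -
    have "hausdorff_distance (integrals (g n)) (integrals G) \<le> dist (g n) G"
      using dist_bounded[of "g n" _ G] by (intro hausdorff_distance_integrals_le) (auto simp: dist_norm)
    then show ?thesis using CB.triangle[OF K RG[of "g n"] RG[of G]] g[of n] by linarith
  qed
  have "(\<lambda>n. d / 2 ^ n + dist (g n) G) \<longlonglongrightarrow> 0 + 0"
  proof (rule tendsto_add)
    show "(\<lambda>n. d / 2 ^ n) \<longlonglongrightarrow> 0"
      by (rule LIMSEQ_divide_realpow_zero) simp
    show "(\<lambda>n. dist (g n) G) \<longlonglongrightarrow> 0" using lim tendsto_dist_iff by blast
  qed
  then have "hausdorff_distance K (integrals G) \<le> 0 + 0"
    using bound by (intro LIMSEQ_le_const) auto
  then have "hausdorff_distance K (integrals G) = 0" using CB.nonneg[of K "integrals G"] by simp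
  then have "integrals G = K" using CB.zero[OF K RG] by auto
  with \<open>dist F G \<le> 6 * d\<close> show ?thesis using that by blast
qed

end

section \<open>Continuity, openness and surjectivity of the rotation map\<close>

theorem theorem1p1:
  fixes T :: "'a::metric_space \<Rightarrow> 'a"
  assumes "compact (UNIV :: 'a set)"
    and "continuous_on UNIV T"
    and "\<not> uniquely_ergodic T"
    and "weak_star_topology T closure_of periodic_measures T = invariant_measures T"
  shows "let R = (rotation_set T :: ('a \<Rightarrow>\<^sub>C (real ^ 'd)) \<Rightarrow> (real ^ 'd) set) in
         continuous_map euclidean hausdorff_topology R \<and>
         open_map euclidean hausdorff_topology R \<and>
         range R = convex_bodies"
proof -
  interpret dense_periodic_system T
    by unfold_locales fact+
  interpret CB: Metric_space "convex_bodies :: (real ^ 'd) set set" hausdorff_distance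
    by (rule Metric_space_convex_bodies)
  let ?R = "rotation_set T :: ('a \<Rightarrow>\<^sub>C (real ^ 'd)) \<Rightarrow> (real ^ 'd) set"
  have R_CB: "?R F \<in> convex_bodies" for F
    by (simp add: rotation_set_eq_integrals integrals_convex_bodies)
  have "continuous_map euclidean CB.mtopology ?R"
    unfolding CB.continuous_map_to_metric
  proof (intro ballI allI impI)
    fix F :: "'a \<Rightarrow>\<^sub>C (real ^ 'd)" and e :: real assume "0 < e"
    have "?R G \<in> CB.mball (?R F) e" if "dist F G < e" for G
    proof -
      have "hausdorff_distance (integrals F) (integrals G) \<le> dist F G"
        using dist_bounded[of F _ G] by (intro hausdorff_distance_integrals_le) (auto simp: dist_norm)
      with that show ?thesis using R_CB by (simp add: rotation_set_eq_integrals)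
    qed
    with \<open>0 < e\<close> show "\<exists>U. openin euclidean U \<and> F \<in> U \<and> (\<forall>G\<in>U. ?R G \<in> CB.mball (?R F) e)"
      by (intro exI[of _ "ball F e"]) auto
  qed
  moreover have "open_map euclidean CB.mtopology ?R"
    unfolding open_map_def CB.openin_mtopology
  proof (intro allI impI conjI)
    fix U :: "('a \<Rightarrow>\<^sub>C (real ^ 'd)) set" and K
    assume U: "openin euclidean U"
    show "?R ` U \<subseteq> convex_bodies" using R_CB by blast
    assume "K \<in> ?R ` U"
    then obtain F where F: "F \<in> U" "K = ?R F" by auto
    then obtain e where e: "0 < e" "cball F e \<subseteq> U" using U open_contains_cball[of U] unfolding open_openin[symmetric] by blast
    \<comment> \<open>Radius \<open>e / 6\<close> offsets the factor 6 in
      \<open>realize_convex_body\<close>; its bound is not strict, hence the closed ball inside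
      \<open>U\<close>.\<close>
    have "CB.mball K (e / 6) \<subseteq> ?R ` U"
    proof
      fix L assume L: "L \<in> CB.mball K (e / 6)"
      then have "L \<in> convex_bodies" "hausdorff_distance L (integrals F) < e / 6"
        using F by (auto simp: rotation_set_eq_integrals hausdorff_distance_commute)
      then obtain G :: "'a \<Rightarrow>\<^sub>C (real ^ 'd)" where "dist F G \<le> 6 * (e / 6)" "integrals G = L"
        using realize_convex_body by blast
      then have "G \<in> U" "L = ?R G"
        using e(2) by (auto simp: rotation_set_eq_integrals)
      then show "L \<in> ?R ` U" by blast
    qed
    with \<open>0 < e\<close> show "\<exists>r>0. CB.mball K r \<subseteq> ?R ` U" by (intro exI[of _ "e / 6"]) auto
  qed
  moreover have "range ?R = convex_bodies"
  proof
    show "range ?R \<subseteq> convex_bodies" using R_CB by blast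
    show "convex_bodies \<subseteq> range ?R"
    proof
      fix K :: "(real ^ 'd) set" assume "K \<in> convex_bodies"
      \<comment> \<open>Here the distance from \<open>F\<close> is irrelevant, so any
        \<open>d\<close> above the distance from \<open>K\<close> to the rotation set of 0 will
        do.\<close>
      then obtain G :: "'a \<Rightarrow>\<^sub>C (real ^ 'd)" where "integrals G = K"
        using realize_convex_body[of K 0 "hausdorff_distance K (integrals (0 :: 'a \<Rightarrow>\<^sub>C (real ^ 'd))) + 1"] by auto
      then show "K \<in> range ?R" by (auto simp: rotation_set_eq_integrals)
    qed
  qed
  ultimately show ?thesis by (simp add: Let_def)
qed

end
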